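(* For $q\in\mathbb{C}$ with $|q|<1$, $$\sum_{i,j\ge0}\frac{q^{\frac{3}{2}i^2+ij+\frac{3}{2}j^2-\frac{1}{2}i+\frac{1}{2}j}}{(q;q)_{2i}(q;q)_{2j}}=\frac{(-q^{5},-q^{7},q^{12};q^{12})_\infty}{(q;q)_\infty},\qquad \sum_{i,j\ge0}\frac{q^{\frac{3}{2}i^2+ij+\frac{3}{2}j^2+\frac{3}{2}i+\frac{5}{2}j}}{(q;q)_{2i+1}(q;q)_{2j+1}}=\frac{(-q,-q^{11},q^{12};q^{12})_\infty}{(q;q)_\infty},$$ $$\sum_{i,j\ge0}\frac{q^{\frac{3}{2}i^2+ij+\frac{3}{2}j^2+\frac{1}{2}i-\frac{1}{2}j}}{(q;q)_{2i+1}(q;q)_{2j}}=\frac{(q^3;q^3)_\infty}{(q;q)_\infty(q,q^5;q^6)_\infty},\qquad \sum_{i,j\ge0}\frac{q^{\frac{3}{2}i^2+ij+\frac{3}{2}j^2+\frac{1}{2}i+\frac{3}{2}j}}{(q;q)_{2i+1}(q;q)_{2j}}=\frac{(-q^{5},-q^{7},q^{12};q^{12})_\infty}{(q;q)_\infty},$$ $$\sum_{i,j\ge0}\frac{q^{\frac{3}{2}i^2+ij+\frac{3}{2}j^2+\frac{5}{2}i-\frac{1}{2}j}}{(q;q)_{2i+1}(q;q)_{2j}}=\frac{(-q,-q^{11},q^{12};q^{12})_\infty}{(q;q)_\infty},\qquad \sum_{i,j\ge0}\frac{q^{\frac{3}{2}i^2+ij+\frac{3}{2}j^2+\frac{3}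{2}i+\frac{1}{2}j}}{(q;q)_{2i+1}(q;q)_{2j}}=\frac{(q^6;q^6)_\infty}{(q;q)_\infty(q^3;q^6)_\infty}.$$
   Context: For $|q|<1$: $(a;q)_\infty=\prod_{k\ge0}(1-aq^k)$; for integers $n\ge0$, $(a;q)_n=\prod_{k=0}^{n-1}(1-aq^k)$; and $(a_1,\dots,a_m;q)_\infty=\prod_{k=1}^m(a_k;q)_\infty$. All exponents of $q$ appearing are integers. *)

theory Defs
  imports "HOL-Analysis.Analysis"
begin

definition qpoch :: "complex \<Rightarrow> complex \<Rightarrow> nat \<Rightarrow> complex" where
  "qpoch a q n = (\<Prod>k<n. 1 - a * q ^ k)"

definition qpoch_inf :: "complex \<Rightarrow> complex \<Rightarrow> complex" where
  "qpoch_inf a q = (\<Prod>k. 1 - a * q ^ k)"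

(* prodinf is an unspecified value on divergent products; for norm q < 1 this does not occur
   (products that vanish because of a zero factor count as convergent). *)
lemma qpoch_inf_has_prod:
  assumes "norm q < 1"
  shows "(\<lambda>k. 1 - a * q ^ k) has_prod qpoch_inf a q"
proof -
  have "summable (\<lambda>k. norm (- (a * q ^ k)))"
    using assms by (simp add: norm_mult norm_power summable_mult)
  then have "abs_convergent_prod (\<lambda>k. 1 + - (a * q ^ k))"
    by (intro summable_imp_abs_convergent_prod) simp
  then have "convergent_prod (\<lambda>k. 1 - a * q ^ k)"
    by (simp add: abs_convergent_prod_imp_convergent_prod)
  then show ?thesis
    unfolding qpoch_inf_def by (rule convergent_prod_has_prod)
qed

definition qpoch_inf_list :: "complex list \<Rightarrow> complex \<Rightarrow> complex" where
  "qpoch_inf_list as q = (\<Prod>a\<leftarrow>as. qpoch_inf a q)"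

end

theory Submission
  imports Defs
begin

text \<open>
  Write $P_n = (q;q)_n$, and let $m$, $n$ be the indices of the two $q$-factorials in the
  denominator of a summand. Since $(m+n)^2/4 = mn + (m-n)^2/4$, the summands are, up to a power
  of $q$, of the form $q^{mn} w(m-n)/(P_m P_n)$, and Cauchy's Durfee rectangle identity
  $\sum_{m-n=e} q^{mn}/(P_m P_n) = 1/(q;q)_\infty$ turns the sum over all $m$, $n$ into
  $\sum_e w(e)/(q;q)_\infty$. The same identity, applied to the product of two of Euler's
  expansions, gives the Jacobi triple product that evaluates these theta series.

  Let $S_1, \dots, S_6$ be the six double sums and $W = \sum_d q^{(3d^2-d)/2}$. A weight $w$
  supported on even $e$ gives $S_1 + q S_2 = W/(q;q)_\infty$, and the $q$-binomial theorem gives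
  $S_1 - q S_2 = 1$; Euler's pentagonal number theorem then separates the even and the odd part
  of $W$. A weight supported on odd $e$ gives $S_4 + q S_5 = W/(q;q)_\infty$. Splitting off one
  factor of a denominator yields $S_3 = S_1 + q S_5$ and $S_4 = S_3 - q S_2$, so that $S_5 = S_2$,
  $S_4 = S_1$ and $S_3 = W/(q;q)_\infty$. For $S_6$ the weight is symmetric, hence $S_6$ is half
  of a theta series divided by $(q;q)_\infty$.
\<close>

subsection \<open>$q$-Pochhammer symbols\<close>

lemma qpoch_0 [simp]: "qpoch a q 0 = 1"
  by (simp add: qpoch_def)

lemma qpoch_Suc: "qpoch a q (Suc n) = qpoch a q n * (1 - a * q ^ n)"
  by (simp add: qpoch_def)

lemma qpoch_Suc_left: "qpoch a q (Suc n) = (1 - a) * qpoch (a * q) q n"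
  unfolding qpoch_def by (subst prod.lessThan_Suc_shift) (simp add: mult.assoc)

lemma qpoch_LIMSEQ:
  assumes "norm q < 1"
  shows "qpoch a q \<longlonglongrightarrow> qpoch_inf a q"
  using has_prod_imp_tendsto'[OF qpoch_inf_has_prod[OF assms]] by (simp add: qpoch_def[abs_def])

lemma one_minus_mult_power_nonzero:
  fixes a q :: complex
  assumes "norm q < 1" "norm a < 1"
  shows "1 - a * q ^ n \<noteq> 0"
proof
  assume "1 - a * q ^ n = 0"
  then have "norm a * norm q ^ n = 1"
    by (metis eq_iff_diff_eq_0 norm_mult norm_one norm_power)
  moreover have "norm a * norm q ^ n \<le> norm a * 1"
    using assms by (intro mult_left_mono power_le_one) auto
  ultimately show False
    using assms by simp
qed

lemma qpoch_nonzero: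
  assumes "norm q < 1" "norm a < 1"
  shows "qpoch a q n \<noteq> 0"
  using one_minus_mult_power_nonzero[OF assms] by (simp add: qpoch_def)

lemma qpoch_inf_nonzero:
  assumes "norm q < 1" "norm a < 1"
  shows "qpoch_inf a q \<noteq> 0"
  using has_prod_eq_0_iff[OF qpoch_inf_has_prod[OF assms(1)]] one_minus_mult_power_nonzero[OF assms]
  by auto

text \<open>The sequence converges, since the limit \<open>qpoch_inf q q\<close> of the denominators
  is nonzero, and convergent sequences are bounded. The bound majorizes the denominators in the
  convergence proofs below.\<close>

lemma inverse_qpoch_bounded:
  assumes "norm q < 1"
  obtains B where "B > 0" "\<And>n. norm (1 / qpoch q q n) \<le> B"
proof -
  have "(\<lambda>n. 1 / qpoch q q n) \<longlonglongrightarrow> 1 / qpoch_inf q q"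
    by (intro tendsto_intros qpoch_LIMSEQ qpoch_inf_nonzero assms)
  then have "Bseq (\<lambda>n. 1 / qpoch q q n)"
    using convergentI convergent_imp_Bseq by blast
  then show ?thesis
    using that by (auto simp: Bseq_def)
qed

text \<open>Groups the factors by the residue of the exponent modulo \<open>r\<close>. Letting
  \<open>n\<close> tend to infinity then dissects the infinite product.\<close>

lemma qpoch_mult_index:
  "qpoch a q (n * r) = (\<Prod>j<r. qpoch (a * q ^ j) (q ^ r) n)"
proof -
  have "qpoch a q (n * r) = (\<Prod>m<n. \<Prod>j = m * r..<m * r + r. 1 - a * q ^ j)"
    unfolding qpoch_def by (rule prod.nat_group[symmetric])
  also have "\<dots> = (\<Prod>m<n. \<Prod>j<r. 1 - a * q ^ (j + m * r))"
  proof (rule prod.cong[OF refl])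
    fix m
    show "(\<Prod>j = m * r..<m * r + r. 1 - a * q ^ j) = (\<Prod>j<r. 1 - a * q ^ (j + m * r))"
      by (rule prod.reindex_bij_witness[of _ "\<lambda>j. j + m * r" "\<lambda>j. j - m * r"]) auto
  qed
  also have "\<dots> = (\<Prod>j<r. \<Prod>m<n. 1 - a * q ^ (j + m * r))"
    by (rule prod.swap)
  finally show ?thesis
    by (simp add: qpoch_def power_add mult.assoc power_mult[symmetric] mult.commute[of r])
qed

lemma qpoch_inf_split:
  assumes "norm q < 1" "r > 0"
  shows "qpoch_inf a q = (\<Prod>j<r. qpoch_inf (a * q ^ j) (q ^ r))"
proof (rule LIMSEQ_unique)
  have "norm (q ^ r) < 1"
    using assms by (simp add: norm_power power_less_one_iff)
  then show "(\<lambda>n. qpoch a q (n * r)) \<longlonglongrightarrow> (\<Prod>j<r. qpoch_inf (a * q ^ j) (q ^ r))"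
    unfolding qpoch_mult_index by (intro tendsto_prod qpoch_LIMSEQ)
  have "filterlim (\<lambda>n. n * r) sequentially sequentially"
    using assms(2) by (intro filterlim_subseq) (auto simp: strict_mono_def)
  then show "(\<lambda>n. qpoch a q (n * r)) \<longlonglongrightarrow> qpoch_inf a q"
    by (rule filterlim_compose[OF qpoch_LIMSEQ[OF assms(1)]])
qed

lemma qpoch_inf_split_3:
  assumes "norm q < 1"
  shows "qpoch_inf a q = qpoch_inf a (q ^ 3) * qpoch_inf (a * q) (q ^ 3) * qpoch_inf (a * q ^ 2) (q ^ 3)"
proof -
  have "{..<3} = {0, 1, 2::nat}"
    by auto
  then show ?thesis
    using qpoch_inf_split[OF assms, of 3 a] by (simp add: mult_ac)
qed

lemma qpoch_inf_first_factor:
  assumes "norm q < 1"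
  shows "qpoch_inf a q = (1 - a) * qpoch_inf (a * q) q"
proof (rule LIMSEQ_unique)
  show "(\<lambda>n. qpoch a q (Suc n)) \<longlonglongrightarrow> qpoch_inf a q"
    using qpoch_LIMSEQ[OF assms] by (rule LIMSEQ_Suc)
  show "(\<lambda>n. qpoch a q (Suc n)) \<longlonglongrightarrow> (1 - a) * qpoch_inf (a * q) q"
    unfolding qpoch_Suc_left by (intro tendsto_intros qpoch_LIMSEQ assms)
qed

lemma qpoch_inf_minus_mult:
  assumes "norm q < 1"
  shows "qpoch_inf (- a) q * qpoch_inf a q = qpoch_inf (a ^ 2) (q ^ 2)"
proof (rule LIMSEQ_unique)
  have "qpoch (- a) q n * qpoch a q n = qpoch (a ^ 2) (q ^ 2) n" for n
    unfolding qpoch_def prod.distrib[symmetric]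
    by (rule prod.cong) (auto simp: algebra_simps power2_eq_square power_mult_distrib)
  then show "qpoch (a ^ 2) (q ^ 2) \<longlonglongrightarrow> qpoch_inf (- a) q * qpoch_inf a q"
    using tendsto_mult[OF qpoch_LIMSEQ[OF assms] qpoch_LIMSEQ[OF assms], of "- a" a] by simp
  show "qpoch (a ^ 2) (q ^ 2) \<longlonglongrightarrow> qpoch_inf (a ^ 2) (q ^ 2)"
    using assms by (intro qpoch_LIMSEQ) (simp add: norm_power power_less_one_iff)
qed

text \<open>Euler's theorem on partitions into distinct and into odd parts. The product of (-q;q)
  and (q;q), and also the even-exponent part of (q;q), equals (q^2;q^2), which is nonzero and
  cancels.\<close>

lemma euler_odd_distinct:
  assumes q: "norm q < 1"
  shows "qpoch_inf (- q) q * qpoch_inf q (q ^ 2) = 1"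
proof -
  have q2: "norm (q ^ 2) < 1"
    using q by (simp add: norm_power power_less_one_iff)
  have "qpoch_inf q q = qpoch_inf q (q ^ 2) * qpoch_inf (q ^ 2) (q ^ 2)"
    using qpoch_inf_split[OF q, of 2 q] by (simp add: numeral_2_eq_2)
  then have "qpoch_inf (- q) q * qpoch_inf q (q ^ 2) * qpoch_inf (q ^ 2) (q ^ 2) = qpoch_inf (q ^ 2) (q ^ 2)"
    using qpoch_inf_minus_mult[OF q, of q] by (simp add: mult_ac)
  then show ?thesis
    using qpoch_inf_nonzero[OF q2 q2] by simp
qed

subsection \<open>Durfee rectangles\<close>

text \<open>Moving one factor between the two denominators gives
  $D_c - D_{c+1} = -q^{c+1} (D_{c+1} - D_{c+2})$ for the sums $D_c$ below; as they are bounded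
  in $c$, they are all equal to their limit $1/(q;q)_\infty$.\<close>

lemma durfee_rectangle:
  assumes q: "norm q < 1"
  shows "((\<lambda>k. q ^ (k * (k + c)) / (qpoch q q k * qpoch q q (k + c))) has_sum 1 / qpoch_inf q q) UNIV"
proof -
  define P where "P = qpoch q q"
  define t where "t c k = q ^ (k * (k + c)) / (P k * P (k + c))" for c k
  define D where "D c = suminf (t c)" for c
  obtain B where B: "B > 0" "\<And>n. norm (1 / P n) \<le> B"
    unfolding P_def using inverse_qpoch_bounded[OF q] by blast
  have P: "P n \<noteq> 0" for n
    using qpoch_nonzero[OF q q] by (simp add: P_def)
  have PS: "P (Suc n) = P n * (1 - q ^ Suc n)" "1 - q ^ Suc n \<noteq> 0" for n
    using one_minus_mult_power_nonzero[OF q q, of n] by (simp_all add: P_def qpoch_Suc)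
  have bd: "norm (t c k) \<le> B ^ 2 * norm q ^ (k * (k + c))" for c k
  proof -
    have "norm (t c k) = norm (1 / P k) * norm (1 / P (k + c)) * norm q ^ (k * (k + c))"
      by (simp add: t_def norm_divide norm_mult norm_power)
    also have "\<dots> \<le> B * B * norm q ^ (k * (k + c))"
      using B by (intro mult_right_mono mult_mono) auto
    finally show ?thesis by (simp add: power2_eq_square)
  qed
  have geo: "summable (\<lambda>k. B ^ 2 * norm q ^ k)" "(\<Sum>k. B ^ 2 * norm q ^ k) = B ^ 2 / (1 - norm q)"
    using q by (auto simp: summable_mult suminf_mult suminf_geometric)
  have bd': "norm (t c k) \<le> B ^ 2 * norm q ^ k" for c k
  proof -
    have "norm q ^ (k * (k + c)) \<le> norm q ^ k"
      using q by (intro power_decreasing) (cases k, auto)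
    then show ?thesis
      using bd[of c k] B by (meson mult_left_mono order_trans zero_le_power2)
  qed
  have sn: "summable (\<lambda>k. norm (t c k))" for c
    by (rule summable_comparison_test'[OF geo(1)]) (use bd' in auto)
  then have s: "summable (t c)" for c
    by (rule summable_norm_cancel)
  have Dbd: "norm (D c) \<le> B ^ 2 / (1 - norm q)" for c
    using norm_suminf_le[of "t c", OF bd' geo(1)] geo(2) by (simp add: D_def)
  have rec: "D c + q ^ Suc c * D (Suc c) = D (Suc c) + q ^ Suc c * D (c + 2)" for c
  proof -
    \<comment> \<open>\<open>e\<close> has the mixed denominator P_k P_(k+c+1). Writing 1 = (1 - x)
      + x with x = q^(k+c+1), or with x = q^k, cancels the last factor of one denominator or of the
      other. The two resulting expansions of the sum of \<open>e\<close> give the recurrence. In the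
      second one the term at k = 0 vanishes, which permits the index shift.\<close>
    define e where "e k = q ^ (k * (k + c)) / (P k * P (Suc (k + c)))" for k
    have 1: "e k = t c k + q ^ Suc c * t (Suc c) k" for k
    proof -
      have "t c k = e k * (1 - q ^ Suc (k + c))"
        using P[of k] P[of "k + c"] PS[of "k + c"] unfolding e_def t_def PS(1)
        by (simp add: divide_simps del: power_Suc)
      moreover have "q ^ Suc c * t (Suc c) k = e k * q ^ Suc (k + c)"
        unfolding e_def t_def by (simp add: power_add[symmetric] algebra_simps flip: power_Suc)
      ultimately show ?thesis
        by (simp only: right_diff_distrib mult_1_right diff_add_cancel)
    qed
    have 2: "e (Suc k) - t (Suc c) (Suc k) = q ^ Suc c * t (c + 2) k" for k
    proof -
      have "t (Suc c) (Suc k) = e (Suc k) * q ^ Suc k"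
        unfolding e_def t_def by (simp add: power_add[symmetric] algebra_simps flip: power_Suc)
      then have "e (Suc k) - t (Suc c) (Suc k) = e (Suc k) * (1 - q ^ Suc k)"
        by (simp only: right_diff_distrib mult_1_right)
      also have "\<dots> = q ^ (Suc k * (Suc k + c)) / (P k * P (Suc (Suc k + c)))"
        using P[of k] PS(2)[of k] unfolding e_def PS(1)[of k] by (simp del: power_Suc)
      also have "\<dots> = q ^ Suc c * t (c + 2) k"
        unfolding t_def by (simp add: power_add[symmetric] algebra_simps flip: power_Suc)
      finally show ?thesis .
    qed
    have "e = (\<lambda>k. t c k + q ^ Suc c * t (Suc c) k)"
      using 1 by blast
    then have e: "e sums (D c + q ^ Suc c * D (Suc c))"
      unfolding D_def by (simp only:) (intro sums_add sums_mult summable_sums s)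
    have "(\<lambda>k. e k - t (Suc c) k) sums (D c + q ^ Suc c * D (Suc c) - D (Suc c))"
      unfolding D_def by (intro sums_diff summable_sums s e[unfolded D_def])
    moreover have "e 0 - t (Suc c) 0 = 0"
      by (simp add: e_def t_def)
    ultimately have "(\<lambda>k. e (Suc k) - t (Suc c) (Suc k)) sums (D c + q ^ Suc c * D (Suc c) - D (Suc c))"
      by (subst sums_Suc_iff) simp
    moreover have "(\<lambda>k. q ^ Suc c * t (c + 2) k) sums (q ^ Suc c * D (c + 2))"
      unfolding D_def by (intro sums_mult summable_sums s)
    ultimately have "D c + q ^ Suc c * D (Suc c) - D (Suc c) = q ^ Suc c * D (c + 2)"
      unfolding 2 by (rule sums_unique2)
    from this[unfolded diff_eq_eq] show ?thesis
      by (rule trans[OF _ add.commute])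
  qed
  have step: "norm (D c - D (Suc c)) \<le> norm q * norm (D (Suc c) - D (Suc (Suc c)))" for c
  proof -
    have "D c - D (Suc c) = - (q ^ Suc c * (D (Suc c) - D (Suc (Suc c))))"
    proof -
      have "a - b = - (x * (b - b'))" if "a + x * b = b + x * b'" for a b b' x :: complex
        using that by algebra
      then show ?thesis
        using rec[of c] unfolding add_2_eq_Suc' by blast
    qed
    then have "norm (D c - D (Suc c)) = norm q ^ Suc c * norm (D (Suc c) - D (Suc (Suc c)))"
      by (simp only: norm_minus_cancel norm_mult norm_power)
    also have "\<dots> \<le> norm q ^ 1 * norm (D (Suc c) - D (Suc (Suc c)))"
      using q by (intro mult_right_mono power_decreasing) auto
    finally show ?thesis by simp
  qed
  have "norm (D c - D (Suc c)) \<le> norm q ^ n * norm (D (c + n) - D (Suc (c + n)))" for c n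
  proof (induction n)
    case (Suc n)
    have "norm q ^ n * norm (D (c + n) - D (Suc (c + n)))
        \<le> norm q ^ n * (norm q * norm (D (Suc (c + n)) - D (Suc (Suc (c + n)))))"
      by (intro mult_left_mono step) auto
    with Suc show ?case by (simp add: mult_ac)
  qed auto
  moreover have "norm (D (c + n) - D (Suc (c + n))) \<le> 2 * (B ^ 2 / (1 - norm q))" for c n
    using norm_triangle_ineq4[of "D (c + n)" "D (Suc (c + n))"] Dbd[of "c + n"] Dbd[of "Suc (c + n)"]
    by linarith
  ultimately have "norm (D c - D (Suc c)) \<le> norm q ^ n * (2 * (B ^ 2 / (1 - norm q)))" for c n
    by (meson mult_left_mono norm_ge_zero order_trans zero_le_power)
  moreover have "(\<lambda>n. norm q ^ n * (2 * (B ^ 2 / (1 - norm q)))) \<longlonglongrightarrow> 0 * (2 * (B ^ 2 / (1 - norm q)))"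
    using q by (intro tendsto_intros LIMSEQ_power_zero) auto
  ultimately have "norm (D c - D (Suc c)) \<le> 0" for c
    by (intro LIMSEQ_le_const[of _ 0]) auto
  then have "D (Suc c) = D c" for c
    by simp
  then have Dc: "D c = D 0" for c
    by (induction c) auto
  \<comment> \<open>The common value is found by letting c tend to infinity: the term at k = 0 is
    1/P_c, and the others are O(|q|^c) because (k+1)(k+1+c) is at least c + k.\<close>
  have "norm (D 0 - 1 / P c) \<le> norm q ^ c * (B ^ 2 / (1 - norm q))" for c
  proof -
    have "D 0 - 1 / P c = (\<Sum>k. t c (Suc k))"
      unfolding Dc[of c, symmetric] using suminf_split_head[OF s[of c]] by (simp add: D_def t_def P_def)
    moreover have "norm (\<Sum>k. t c (Suc k)) \<le> (\<Sum>k. norm q ^ c * (B ^ 2 * norm q ^ k))"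
    proof (rule norm_suminf_le)
      fix k
      have "norm q ^ (Suc k * (Suc k + c)) \<le> norm q ^ (c + k)"
        using q by (intro power_decreasing) auto
      then have "norm (t c (Suc k)) \<le> B ^ 2 * norm q ^ (c + k)"
        using bd[of c "Suc k"] by (meson mult_left_mono order_trans zero_le_power2)
      then show "norm (t c (Suc k)) \<le> norm q ^ c * (B ^ 2 * norm q ^ k)"
        by (simp add: power_add mult_ac)
    qed (intro summable_mult geo)
    ultimately show ?thesis
      using geo by (simp add: suminf_mult)
  qed
  moreover have "(\<lambda>c. norm q ^ c * (B ^ 2 / (1 - norm q))) \<longlonglongrightarrow> 0 * (B ^ 2 / (1 - norm q))"
    using q by (intro tendsto_intros LIMSEQ_power_zero) auto
  ultimately have "(\<lambda>c. D 0 - 1 / P c) \<longlonglongrightarrow> 0"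
    by (intro Lim_null_comparison[of "\<lambda>c. D 0 - 1 / P c" "\<lambda>c. norm q ^ c * (B ^ 2 / (1 - norm q))"]) auto
  moreover have "(\<lambda>c. D 0 - 1 / P c) \<longlonglongrightarrow> D 0 - 1 / qpoch_inf q q"
    unfolding P_def by (intro tendsto_intros qpoch_LIMSEQ qpoch_inf_nonzero q)
  ultimately have "D 0 = 1 / qpoch_inf q q"
    using LIMSEQ_unique by fastforce
  then have "t c sums (1 / qpoch_inf q q)"
    using summable_sums[OF s[of c]] Dc[of c] by (simp add: D_def)
  from norm_summable_imp_has_sum[OF sn this] show ?thesis
    by (simp add: t_def[abs_def] P_def)
qed

section \<open>Products of series and summation along diagonals\<close>

text \<open>Summability over complex numbers is absolute, so the product of the two norm sums
  controls the double family, and iterated summation is legitimate.\<close>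

lemma has_sum_product_complex:
  fixes f :: "'a \<Rightarrow> complex" and g :: "'b \<Rightarrow> complex"
  assumes f: "(f has_sum F) A" and g: "(g has_sum G) B"
  shows "((\<lambda>(x, y). f x * g y) has_sum F * G) (A \<times> B)"
proof (rule has_sum_SigmaI)
  show "((\<lambda>y. case (x, y) of (x, y) \<Rightarrow> f x * g y) has_sum f x * G) B" for x
    using has_sum_cmult_right[OF g] by simp
  show "((\<lambda>x. f x * G) has_sum F * G) A"
    by (rule has_sum_cmult_left[OF f])
  have fn: "(\<lambda>x. norm (f x)) summable_on A" and gn: "(\<lambda>x. norm (g x)) summable_on B"
    using f g has_sum_imp_summable summable_on_iff_abs_summable_on_complex by blast+
  have "(\<lambda>(x, y). norm (f x) * norm (g y)) summable_on A \<times> B"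
  proof (rule summable_on_SigmaI)
    show "((\<lambda>y. case (x, y) of (x, y) \<Rightarrow> norm (f x) * norm (g y)) has_sum
            norm (f x) * infsum (\<lambda>y. norm (g y)) B) B" for x
      using has_sum_cmult_right[OF has_sum_infsum[OF gn]] by simp
    show "(\<lambda>x. norm (f x) * infsum (\<lambda>y. norm (g y)) B) summable_on A"
      by (rule summable_on_cmult_left[OF fn])
  qed auto
  then have "(\<lambda>p. norm (case p of (x, y) \<Rightarrow> f x * g y)) summable_on A \<times> B"
    by (simp add: case_prod_beta' norm_mult)
  then show "(\<lambda>(x, y). f x * g y) summable_on A \<times> B"
    using summable_on_iff_abs_summable_on_complex by blast
qed

text \<open>A pair is encoded by its difference \<open>e\<close> and its minimum \<open>k\<close>.
  As \<open>nat\<close> truncates negative integers to 0, at least one of \<open>nat e\<close> and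
  \<open>nat (- e)\<close> is 0.\<close>

lemma has_sum_diagonals_iff:
  "((\<lambda>(m, n). f m n) has_sum S) (UNIV :: (nat \<times> nat) set) \<longleftrightarrow>
   ((\<lambda>(e, k). f (k + nat e) (k + nat (- e))) has_sum S) (UNIV \<times> UNIV :: (int \<times> nat) set)"
proof -
  have "min m n + nat (int m - int n) = m" "min m n + nat (int n - int m) = n" for m n
    by auto
  then show ?thesis
    by (intro has_sum_reindex_bij_witness[of _ "\<lambda>(e, k). (k + nat e, k + nat (- e))"
          "\<lambda>(m, n). (int m - int n, min m n)"]) auto
qed

lemma durfee_diagonal:
  assumes "norm q < 1"
  shows "((\<lambda>k. q ^ ((k + nat e) * (k + nat (- e))) / (qpoch q q (k + nat e) * qpoch q q (k + nat (- e))))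
           has_sum 1 / qpoch_inf q q) UNIV"
  using durfee_rectangle[OF assms, of "nat e"] durfee_rectangle[OF assms, of "nat (- e)"]
  by (cases "e \<ge> 0") (simp_all add: mult_ac)

text \<open>On the diagonal m - n = e the weight is the constant \<open>w e\<close>, and what
  remains is a Durfee sum, whose value does not depend on \<open>e\<close>.\<close>

lemma durfee_weighted_sum:
  assumes q: "norm q < 1" and w: "(w has_sum W) (UNIV :: int set)"
  shows "((\<lambda>(m, n). q ^ (m * n) * w (int m - int n) / (qpoch q q m * qpoch q q n))
           has_sum W / qpoch_inf q q) UNIV"
proof -
  define P where "P = qpoch q q"
  define f where "f m n = q ^ (m * n) * w (int m - int n) / (P m * P n)" for m n
  obtain B where B: "B > 0" "\<And>n. norm (1 / P n) \<le> B"
    unfolding P_def using inverse_qpoch_bounded[OF q] by blast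
  have "((\<lambda>(e, k). f (k + nat e) (k + nat (- e))) has_sum W / qpoch_inf q q) (UNIV \<times> UNIV)"
  proof (rule has_sum_SigmaI)
    fix e
    have "f (k + nat e) (k + nat (- e)) = w e *
        (q ^ ((k + nat e) * (k + nat (- e))) / (P (k + nat e) * P (k + nat (- e))))" for k
      unfolding f_def by (cases "e \<ge> 0") auto
    then show "((\<lambda>k. case (e, k) of (e, k) \<Rightarrow> f (k + nat e) (k + nat (- e)))
        has_sum w e * (1 / qpoch_inf q q)) UNIV"
      using has_sum_cmult_right[OF durfee_diagonal[OF q, of e], of "w e"] by (simp add: P_def)
  next
    show "((\<lambda>e. w e * (1 / qpoch_inf q q)) has_sum W / qpoch_inf q q) UNIV"
      using has_sum_cmult_left[OF w, of "1 / qpoch_inf q q"] by simp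
  next
    \<comment> \<open>The majorant is |w e| |q|^k B^2: the product mn is at least k on every
      diagonal, also when k = 0.\<close>
    have "((\<lambda>k. q ^ k) has_sum (1 / (1 - q))) UNIV"
      using q by (intro norm_summable_imp_has_sum geometric_sums) (auto simp: norm_power)
    then have "(\<lambda>(e, k). w e * q ^ k) summable_on (UNIV \<times> UNIV)"
      using has_sum_product_complex[OF w] has_sum_imp_summable by blast
    then have "(\<lambda>p. norm (case p of (e, k) \<Rightarrow> w e * q ^ k)) summable_on (UNIV \<times> UNIV)"
      using summable_on_iff_abs_summable_on_complex by blast
    then have 1: "(\<lambda>p. norm (case p of (e, k) \<Rightarrow> w e * q ^ k) * B\<^sup>2) summable_on (UNIV \<times> UNIV)"
      by (rule summable_on_cmult_left)
    have 2: "norm (f (k + nat e) (k + nat (- e))) \<le> norm (w e * q ^ k) * B\<^sup>2" for e k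
    proof -
      have "norm (f m n) = norm (w (int m - int n)) * norm q ^ (m * n) * (norm (1 / P m) * norm (1 / P n))" for m n
        by (simp add: f_def norm_mult norm_divide norm_power)
      moreover have "norm (1 / P m) * norm (1 / P n) \<le> B\<^sup>2" for m n
        unfolding power2_eq_square using B by (intro mult_mono) auto
      moreover have "norm q ^ ((k + nat e) * (k + nat (- e))) \<le> norm q ^ k"
      proof (rule power_decreasing)
        show "k \<le> (k + nat e) * (k + nat (- e))"
          by (cases k) auto
      qed (use q in auto)
      moreover have "int (k + nat e) - int (k + nat (- e)) = e"
        by auto
      ultimately show ?thesis
        by (simp add: norm_mult norm_power del: norm_divide) (intro mult_mono mult_nonneg_nonneg; simp)
    qed
    have "(\<lambda>p. norm (case p of (e, k) \<Rightarrow> f (k + nat e) (k + nat (- e)))) summable_on (UNIV \<times> UNIV)"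
      by (rule Infinite_Sum.abs_summable_on_comparison_test'[OF 1]) (use 2 in auto)
    then show "(\<lambda>(e, k). f (k + nat e) (k + nat (- e))) summable_on (UNIV \<times> UNIV)"
      using summable_on_iff_abs_summable_on_complex by blast
  qed
  then show ?thesis
    unfolding has_sum_diagonals_iff[symmetric] by (simp add: f_def[abs_def] P_def)
qed

subsection \<open>The $q$-binomial theorem and the triple product\<close>

lemma Suc_choose_two: "Suc m choose 2 = m + (m choose 2)"
  by (simp add: numeral_2_eq_2)

text \<open>Induction on \<open>M\<close> for all \<open>x\<close> at once. The identity 1 - q^(M+1)
  = q^m (1 - q^(M+1-m)) + (1 - q^m) cancels the last factor of one or the other denominator. Both
  parts reduce to the sum \<open>T\<close> for \<open>M\<close> at \<open>x * q\<close>, with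
  coefficients 1 and -x, and (1 - x) is the first factor of
  \<open>qpoch x q (Suc M)\<close>.\<close>

lemma q_binomial:
  assumes q: "norm q < 1"
  shows "(\<Sum>m\<le>M. (-1) ^ m * q ^ (m choose 2) * x ^ m / (qpoch q q m * qpoch q q (M - m)))
           = qpoch x q M / qpoch q q M"
proof (induction M arbitrary: x)
  case (Suc M)
  define P where "P = qpoch q q"
  have P: "P n \<noteq> 0" for n
    using qpoch_nonzero[OF q q] by (simp add: P_def)
  have PS: "P (Suc n) = P n * (1 - q ^ Suc n)" "1 - q ^ Suc n \<noteq> 0" for n
    using one_minus_mult_power_nonzero[OF q q, of n] by (simp_all add: P_def qpoch_Suc)
  define a where "a m = (-1) ^ m * q ^ (m choose 2)" for m
  define T where "T = (\<Sum>m\<le>M. a m * (x * q) ^ m / (P m * P (M - m)))"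
  have split: "(1 - q ^ Suc M) * (a m * x ^ m / (P m * P (Suc M - m)))
      = a m * (x * q) ^ m * (1 - q ^ (Suc M - m)) / (P m * P (Suc M - m))
        + a m * x ^ m * (1 - q ^ m) / (P m * P (Suc M - m))" if "m \<le> Suc M" for m
  proof -
    have "q ^ Suc M = q ^ m * q ^ (Suc M - m)"
      using that by (simp flip: power_add del: power_Suc)
    then show ?thesis
      by (simp add: field_simps power_mult_distrib del: power_Suc)
        (simp add: algebra_simps flip: add_divide_distrib diff_divide_distrib)
  qed
  have 1: "(\<Sum>m\<le>Suc M. a m * (x * q) ^ m * (1 - q ^ (Suc M - m)) / (P m * P (Suc M - m))) = T"
  proof -
    have "a m * (x * q) ^ m * (1 - q ^ (Suc M - m)) / (P m * P (Suc M - m))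
        = a m * (x * q) ^ m / (P m * P (M - m))" if "m \<le> M" for m
      using P PS(2)[of "M - m"] unfolding Suc_diff_le[OF that] PS(1) by (simp del: power_Suc)
    then show ?thesis
      unfolding T_def sum.atMost_Suc by (simp del: power_Suc)
  qed
  have "(\<Sum>m\<le>Suc M. a m * x ^ m * (1 - q ^ m) / (P m * P (Suc M - m)))
     = (\<Sum>m\<le>M. a (Suc m) * x ^ Suc m * (1 - q ^ Suc m) / (P (Suc m) * P (M - m)))"
    by (subst sum.atMost_Suc_shift) simp
  also have "\<dots> = (\<Sum>m\<le>M. - x * (a m * (x * q) ^ m / (P m * P (M - m))))"
  proof (rule sum.cong[OF refl])
    fix m
    show "a (Suc m) * x ^ Suc m * (1 - q ^ Suc m) / (P (Suc m) * P (M - m))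
        = - x * (a m * (x * q) ^ m / (P m * P (M - m)))"
      using P[of m] PS(2)[of m] unfolding PS(1)
      by (simp add: a_def Suc_choose_two power_add power_mult_distrib del: power_Suc) simp
  qed
  also have "\<dots> = - x * T"
    unfolding T_def by (rule sum_distrib_left[symmetric])
  finally have 2: "(\<Sum>m\<le>Suc M. a m * x ^ m * (1 - q ^ m) / (P m * P (Suc M - m))) = - x * T" .
  have "(1 - q ^ Suc M) * (\<Sum>m\<le>Suc M. a m * x ^ m / (P m * P (Suc M - m)))
      = (\<Sum>m\<le>Suc M. a m * (x * q) ^ m * (1 - q ^ (Suc M - m)) / (P m * P (Suc M - m))
        + a m * x ^ m * (1 - q ^ m) / (P m * P (Suc M - m)))"
    unfolding sum_distrib_left by (rule sum.cong[OF refl], rule split) simp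
  also have "\<dots> = T + - x * T"
    unfolding sum.distrib 1 2 ..
  also have "T = qpoch (x * q) q M / P M"
    using Suc.IH[of "x * q"] by (simp add: T_def a_def P_def)
  finally have "(1 - q ^ Suc M) * (\<Sum>m\<le>Suc M. a m * x ^ m / (P m * P (Suc M - m)))
     = qpoch x q (Suc M) / P M"
    using P by (simp add: qpoch_Suc_left field_simps del: power_Suc)
  then have "(\<Sum>m\<le>Suc M. a m * x ^ m / (P m * P (Suc M - m))) = qpoch x q (Suc M) / P (Suc M)"
    using PS(2)[of M] P unfolding PS(1) by (simp add: field_simps del: power_Suc sum.atMost_Suc)
  then show ?case
    by (simp add: a_def P_def)
qed (simp add: binomial_eq_0)

text \<open>Euler's expansion follows from the functional equation $F(x) = (1 - x) F(xq)$ and $F(0) = 1$.\<close>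

lemma euler_q_exponential:
  assumes q: "norm q < 1"
  shows "((\<lambda>m. (-1) ^ m * q ^ (m choose 2) * x ^ m / qpoch q q m) has_sum qpoch_inf x q) UNIV"
proof -
  define P where "P = qpoch q q"
  define a where "a m = (-1) ^ m * q ^ (m choose 2) / P m" for m
  define F where "F y = (\<Sum>m. a m * y ^ m)" for y
  have PS: "P (Suc n) = P n * (1 - q ^ Suc n)" "1 - q ^ Suc n \<noteq> 0" for n
    using one_minus_mult_power_nonzero[OF q q, of n] by (simp_all add: P_def qpoch_Suc)
  obtain B where B: "B > 0" "\<And>n. norm (1 / P n) \<le> B"
    unfolding P_def using inverse_qpoch_bounded[OF q] by blast
  have sn: "summable (\<lambda>m. norm (a m * y ^ m))" for y
  proof (rule summable_comparison_test')
    define b where "b m = norm q ^ (m choose 2) * norm y ^ m" for m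
    \<comment> \<open>This is the ratio of consecutive terms of \<open>b\<close>. It tends to 0, so
      the power series converges everywhere.\<close>
    have "(\<lambda>m. norm q ^ m * norm y) \<longlonglongrightarrow> 0 * norm y"
      using q by (intro tendsto_intros LIMSEQ_power_zero) auto
    then have "eventually (\<lambda>m. norm q ^ m * norm y < 1 / 2) sequentially"
      by (rule order_tendstoD) auto
    then obtain N where N: "\<And>m. m \<ge> N \<Longrightarrow> norm q ^ m * norm y < 1 / 2"
      by (auto simp: eventually_at_top_linorder)
    have "summable b"
    proof (rule summable_ratio_test[of "1 / 2" N])
      fix m assume "m \<ge> N"
      have "b (Suc m) = norm q ^ m * norm y * b m"
        by (simp add: b_def Suc_choose_two power_add)
      also have "\<dots> \<le> 1 / 2 * b m"
        using N[OF \<open>m \<ge> N\<close>] by (intro mult_right_mono) (auto simp: b_def)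
      finally show "norm (b (Suc m)) \<le> 1 / 2 * norm (b m)"
        by (simp add: b_def)
    qed auto
    then show "summable (\<lambda>m. B * b m)"
      by (rule summable_mult)
    fix m
    have "norm (a m * y ^ m) = norm (1 / P m) * b m"
      by (simp add: a_def b_def norm_mult norm_divide norm_power)
    then show "norm (norm (a m * y ^ m)) \<le> B * b m"
      using B by (simp add: b_def mult_right_mono del: norm_divide)
  qed
  then have s: "summable (\<lambda>m. a m * y ^ m)" for y
    by (rule summable_norm_cancel)
  have F_eq: "F y = (1 - y) * F (y * q)" for y
  proof -
    \<comment> \<open>The coefficients of F(y) - F(yq) are a_m (1 - q^m), and a_(m+1) (1 - q^(m+1))
      = -a_m q^m. Shifting the index by one thus turns the difference into -y F(yq).\<close>
    define d where "d m = a m * y ^ m - a m * (y * q) ^ m" for m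
    have "d (Suc m) = - y * (a m * (y * q) ^ m)" for m
    proof -
      have "a (Suc m) * (1 - q ^ Suc m) = - a m * q ^ m"
        using PS(2)[of m] unfolding a_def PS(1)
        by (simp add: Suc_choose_two power_add del: power_Suc) simp
      moreover have "d (Suc m) = a (Suc m) * (1 - q ^ Suc m) * y ^ Suc m"
        by (simp add: d_def power_mult_distrib algebra_simps)
      ultimately show ?thesis
        by (simp add: power_mult_distrib)
    qed
    moreover have "(\<lambda>m. - y * (a m * (y * q) ^ m)) sums (- y * F (y * q))"
      unfolding F_def by (intro sums_mult summable_sums s)
    moreover have "d 0 = 0"
      by (simp add: d_def)
    ultimately have "d sums (- y * F (y * q))"
      using sums_Suc_iff[of d "- y * F (y * q)"] by simp
    moreover have "d sums (F y - F (y * q))"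
      unfolding d_def F_def by (intro sums_diff summable_sums s)
    ultimately have "- y * F (y * q) = F y - F (y * q)"
      by (rule sums_unique2)
    then show ?thesis
      by (simp add: algebra_simps)
  qed
  have F_iter: "F x = qpoch x q n * F (x * q ^ n)" for n
  proof (induction n)
    case (Suc n)
    then show ?case
      using F_eq[of "x * q ^ n"] by (simp add: qpoch_Suc mult_ac)
  qed simp
  \<comment> \<open>Continuity of the power series at 0 allows the limit in F(x) = (x;q)_n F(x
    q^n).\<close>
  have "(\<lambda>n. x * q ^ n) \<longlonglongrightarrow> x * 0"
    using q by (intro tendsto_intros LIMSEQ_power_zero)
  moreover have "isCont F 0"
    unfolding F_def using s by (rule isCont_powser_converges_everywhere)
  ultimately have "(\<lambda>n. F (x * q ^ n)) \<longlonglongrightarrow> F 0"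
    using isCont_tendsto_compose by fastforce
  moreover have "F 0 = 1"
    unfolding F_def by (subst powser_zero) (simp add: a_def P_def binomial_eq_0)
  ultimately have "(\<lambda>n. qpoch x q n * F (x * q ^ n)) \<longlonglongrightarrow> qpoch_inf x q * 1"
    by (intro tendsto_mult qpoch_LIMSEQ q) simp
  then have "F x = qpoch_inf x q"
    unfolding F_iter[symmetric] by (simp add: LIMSEQ_const_iff)
  then have "(\<lambda>m. a m * x ^ m) sums qpoch_inf x q"
    using summable_sums[OF s[of x]] by (simp add: F_def)
  from norm_summable_imp_has_sum[OF sn this] show ?thesis
    by (simp add: a_def P_def)
qed

section \<open>The triple product and theta series\<close>

lemma int_choose_two: "2 * int (m choose 2) = int m * (int m - 1)"
  by (induction m) (simp_all add: Suc_choose_two algebra_simps)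

text \<open>The binomial coefficient "d choose 2" extended to negative \<open>d\<close>; the
  division is exact.\<close>

definition tri :: "int \<Rightarrow> int" where
  "tri d = d * (d - 1) div 2"

lemma two_tri: "2 * tri d = d * (d - 1)"
  by (simp add: tri_def)

text \<open>With C(d) for \<open>tri d\<close>, the relation C(m) + C(n) + n = C(m-n) + mn makes
  each term in the product of Euler's expansions of (-z;q) and (-q/z;q) equal to w(m-n) q^(mn)/(P_m
  P_n). Each diagonal then contributes w(e)/(q;q).\<close>

lemma jacobi_triple_product:
  assumes q: "norm q < 1" "q \<noteq> 0" and z: "z \<noteq> 0"
  shows "((\<lambda>e::int. z powi e * q powi tri e) has_sum
           qpoch_inf (- z) q * qpoch_inf (- (q / z)) q * qpoch_inf q q) UNIV"
proof -
  define P where "P = qpoch q q"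
  define w where "w e = z powi e * q powi tri e" for e
  have euler: "((\<lambda>m. q ^ (m choose 2) * y ^ m / P m) has_sum qpoch_inf (- y) q) UNIV" for y
    using euler_q_exponential[OF q(1), of "- y"] by (simp add: P_def power_minus' mult_ac)
  have "((\<lambda>(m, n). (q ^ (m choose 2) * z ^ m / P m) * (q ^ (n choose 2) * (q / z) ^ n / P n))
      has_sum qpoch_inf (- z) q * qpoch_inf (- (q / z)) q) (UNIV \<times> UNIV)"
    by (intro has_sum_product_complex euler)
  moreover have "(q ^ (m choose 2) * z ^ m / P m) * (q ^ (n choose 2) * (q / z) ^ n / P n)
      = w (int m - int n) * (q ^ (m * n) / (P m * P n))" for m n
  proof -
    have "2 * tri (int m - int n) + 2 * int (m * n)
        = 2 * (int (m choose 2) + int (n choose 2) + int n)"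
      unfolding two_tri distrib_left int_choose_two by (simp add: algebra_simps)
    moreover have "a + b = c" if "2 * a + 2 * b = 2 * c" for a b c :: int
      using that by simp
    ultimately have "tri (int m - int n) + int (m * n)
        = int (m choose 2) + int (n choose 2) + int n"
      by blast
    then have "q powi tri (int m - int n) * q ^ (m * n)
        = q ^ (m choose 2) * q ^ (n choose 2) * q ^ n"
      using q by (simp flip: power_int_of_nat power_int_add)
    note exponents = this
    have "(q ^ (m choose 2) * z ^ m / P m) * (q ^ (n choose 2) * (q / z) ^ n / P n)
        = q ^ (m choose 2) * q ^ (n choose 2) * q ^ n * (z ^ m / z ^ n) / (P m * P n)"
      by (simp add: power_divide mult_ac)
    also have "\<dots> = w (int m - int n) * (q ^ (m * n) / (P m * P n))"
      unfolding exponents[symmetric] using z by (simp add: w_def power_int_diff)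
    finally show ?thesis .
  qed
  ultimately have "((\<lambda>(m, n). w (int m - int n) * (q ^ (m * n) / (P m * P n)))
      has_sum qpoch_inf (- z) q * qpoch_inf (- (q / z)) q) UNIV"
    by (simp only: UNIV_Times_UNIV)
  then have "((\<lambda>(e, k). w e * (q ^ ((k + nat e) * (k + nat (- e))) / (P (k + nat e) * P (k + nat (- e)))))
      has_sum qpoch_inf (- z) q * qpoch_inf (- (q / z)) q) (UNIV \<times> UNIV)"
    unfolding has_sum_diagonals_iff
    by (rule has_sum_cong[THEN iffD1, rotated]) auto
  \<comment> \<open>Here the total over all pairs is already known, so summing the diagonals first
    also yields convergence of the theta series.\<close>
  then have "((\<lambda>e. w e * (1 / qpoch_inf q q)) has_sum qpoch_inf (- z) q * qpoch_inf (- (q / z)) q) UNIV"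
  proof (rule has_sum_SigmaD)
    fix e
    show "((\<lambda>k. case (e, k) of (e, k) \<Rightarrow> w e * (q ^ ((k + nat e) * (k + nat (- e))) / (P (k + nat e) * P (k + nat (- e)))))
        has_sum w e * (1 / qpoch_inf q q)) UNIV"
      using has_sum_cmult_right[OF durfee_diagonal[OF q(1), of e], of "w e"] by (simp add: P_def)
  qed
  from has_sum_cmult_left[OF this, of "qpoch_inf q q"] show ?thesis
    using qpoch_inf_nonzero[OF q(1) q(1)] by (simp add: w_def[abs_def])
qed

lemma tri_eqI: "2 * x = d * (d - 1) \<Longrightarrow> tri d = x"
  using two_tri[of d] by linarith

text \<open>The triple product with base q^r and z = \<open>\<epsilon> * q powi s\<close>. The
  values 1 and -1 of \<open>\<epsilon>\<close> give the plain and the alternating series.\<close>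

lemma theta_has_sum:
  assumes q: "norm q < 1" "q \<noteq> 0" and r: "r > 0" and \<epsilon>: "\<epsilon> \<noteq> 0"
  shows "((\<lambda>d. \<epsilon> powi d * q powi (int r * tri d + s * d)) has_sum
           qpoch_inf (- (\<epsilon> * q powi s)) (q ^ r) * qpoch_inf (- (q powi (int r - s) / \<epsilon>)) (q ^ r)
             * qpoch_inf (q ^ r) (q ^ r)) UNIV"
proof -
  have "norm (q ^ r) < 1"
    using q r by (simp add: norm_power power_less_one_iff)
  then have "((\<lambda>e::int. (\<epsilon> * q powi s) powi e * (q ^ r) powi tri e) has_sum
      qpoch_inf (- (\<epsilon> * q powi s)) (q ^ r) * qpoch_inf (- (q ^ r / (\<epsilon> * q powi s))) (q ^ r)
        * qpoch_inf (q ^ r) (q ^ r)) UNIV"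
    using q \<epsilon> by (intro jacobi_triple_product) auto
  moreover have "(\<epsilon> * q powi s) powi e * (q ^ r) powi tri e = \<epsilon> powi e * q powi (int r * tri e + s * e)" for e
  proof -
    have "(\<epsilon> * q powi s) powi e = \<epsilon> powi e * q powi (s * e)"
      unfolding power_int_mult_distrib power_int_mult ..
    moreover have "q powi (int r * tri e + s * e) = q powi (int r * tri e) * q powi (s * e)"
      using q by (intro power_int_add) auto
    ultimately show ?thesis
      unfolding power_int_power by (simp only: mult_ac)
  qed
  moreover have "q ^ r / (\<epsilon> * q powi s) = q powi (int r - s) / \<epsilon>"
    using q by (simp add: power_int_diff mult_ac)
  ultimately show ?thesis
    by (simp only:)
qed

section \<open>Splitting sums by parity\<close>

lemma has_sum_even_int:
  assumes "((\<lambda>d. w (2 * d)) has_sum W) UNIV" "\<And>e. odd e \<Longrightarrow> w e = 0"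
  shows "(w has_sum W) (UNIV :: int set)"
proof -
  have "(w has_sum W) (range (\<lambda>d. 2 * d))"
    using assms(1) by (subst has_sum_reindex) (auto simp: inj_def o_def)
  also have "range (\<lambda>d. 2 * d) = {e :: int. even e}"
    by (auto elim: evenE)
  finally show ?thesis
    by (rule has_sum_cong_neutral[THEN iffD1, rotated -1]) (auto simp: assms(2))
qed

lemma has_sum_odd_int:
  assumes "((\<lambda>d. w (2 * d + 1)) has_sum W) UNIV" "\<And>e. even e \<Longrightarrow> w e = 0"
  shows "(w has_sum W) (UNIV :: int set)"
proof -
  have "(w has_sum W) (range (\<lambda>d. 2 * d + 1))"
    using assms(1) by (subst has_sum_reindex) (auto simp: inj_def o_def)
  also have "range (\<lambda>d. 2 * d + 1) = {e :: int. odd e}"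
    by (auto elim: oddE)
  finally show ?thesis
    by (rule has_sum_cong_neutral[THEN iffD1, rotated -1]) (auto simp: assms(2))
qed

text \<open>Subfamilies of a summable family are summable, so the four partial sums exist.
  Convergence of the individual double sums is obtained from this.\<close>

lemma has_sum_parity_classes:
  fixes f :: "nat \<Rightarrow> nat \<Rightarrow> complex"
  assumes f: "((\<lambda>(m, n). f m n) has_sum S) UNIV"
  obtains A B C D where
    "((\<lambda>(i, j). f (2 * i) (2 * j)) has_sum A) UNIV"
    "((\<lambda>(i, j). f (2 * i) (2 * j + 1)) has_sum B) UNIV"
    "((\<lambda>(i, j). f (2 * i + 1) (2 * j)) has_sum C) UNIV"
    "((\<lambda>(i, j). f (2 * i + 1) (2 * j + 1)) has_sum D) UNIV"
    "S = A + B + C + D"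
proof -
  define F where "F = (\<lambda>(m, n). f m n)"
  have F: "(F has_sum S) UNIV"
    using f by (simp add: F_def)
  define R where "R = {..<2::nat} \<times> {..<2::nat}"
  define Q where "Q a b = infsum (\<lambda>(i, j). F (2 * i + a, 2 * j + b)) UNIV" for a b
  have Q: "((\<lambda>(i, j). F (2 * i + a, 2 * j + b)) has_sum Q a b) UNIV" for a b
  proof -
    have "F summable_on range (\<lambda>(i, j). (2 * i + a, 2 * j + b))"
      using has_sum_imp_summable[OF F] by (rule summable_on_subset_banach) auto
    then have "F \<circ> (\<lambda>(i, j). (2 * i + a, 2 * j + b)) summable_on UNIV"
      by (subst (asm) summable_on_reindex) (auto simp: inj_def)
    then show ?thesis
      unfolding Q_def by (intro has_sum_infsum) (simp add: o_def case_prod_beta')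
  qed
  \<comment> \<open>Division with remainder by 2 in both coordinates; \<open>R\<close> collects the
    four pairs of remainders.\<close>
  have "((\<lambda>((a, b), (i, j)). F (2 * i + a, 2 * j + b)) has_sum S) (R \<times> UNIV)"
  proof (rule has_sum_reindex_bij_witness[THEN iffD1, OF _ _ _ _ _ _ F])
    show "(\<lambda>((a, b), (i, j)). (2 * i + a, 2 * j + b)) ((\<lambda>(m, n). ((m mod 2, n mod 2), (m div 2, n div 2))) p) = p"
      for p :: "nat \<times> nat" by (auto simp: case_prod_beta')
    show "(\<lambda>(m, n). ((m mod 2, n mod 2), (m div 2, n div 2))) ((\<lambda>((a, b), (i, j)). (2 * i + a, 2 * j + b)) x) = x"
      if "x \<in> R \<times> UNIV" for x using that by (auto simp: R_def)
  qed (auto simp: R_def)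
  then have "((\<lambda>(a, b). Q a b) has_sum S) R"
    by (rule has_sum_SigmaD) (use Q in auto)
  then have "S = (\<Sum>(a, b)\<in>R. Q a b)"
    by (rule has_sum_unique) (auto simp: R_def)
  also have "R = {(0, 0), (0, 1), (1, 0), (1, 1)}"
    by (auto simp: R_def)
  finally have "S = Q 0 0 + Q 0 1 + Q 1 0 + Q 1 1"
    by simp
  then show ?thesis
    using that[of "Q 0 0" "Q 0 1" "Q 1 0" "Q 1 1"] Q[of 0 0] Q[of 0 1] Q[of 1 0] Q[of 1 1]
    by (simp add: F_def)
qed

subsection \<open>The double sums\<close>

text \<open>One family for all six sums. With N = i + j and D = i - j, the form N^2 +
  \<open>tri D\<close> is 3i^2/2 + ij + 3j^2/2 - i/2 + j/2, and \<open>k\<close>, \<open>l\<close>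
  adjust the linear part. In the order of the theorem the parameters \<open>(a, b, k, l)\<close> are
  (0,0,0,0), (1,1,2,0), (1,0,0,1), (1,0,1,0), (1,0,1,2), (1,0,1,1).\<close>

definition summand :: "complex \<Rightarrow> nat \<Rightarrow> nat \<Rightarrow> int \<Rightarrow> int \<Rightarrow> nat \<Rightarrow> nat \<Rightarrow> complex" where
  "summand q a b k l i j =
     q powi ((int i + int j)\<^sup>2 + k * (int i + int j) + tri (int i - int j) + l * (int i - int j))
       / (qpoch q q (2 * i + a) * qpoch q q (2 * j + b))"

definition lattice_term :: "complex \<Rightarrow> (int \<Rightarrow> complex) \<Rightarrow> nat \<Rightarrow> nat \<Rightarrow> complex" where
  "lattice_term q w m n = q ^ (m * n) * w (int m - int n) / (qpoch q q m * qpoch q q n)"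

text \<open>For m, n of equal parity \<open>e div 2\<close> is D = i - j. Since 4ij = N^2 - D^2,
  this weight restores the exponent N^2 + \<open>tri D\<close>; vanishing at odd \<open>e\<close>
  removes the mixed classes.\<close>

definition even_weight :: "complex \<Rightarrow> int \<Rightarrow> complex" where
  "even_weight q e = (if even e then q powi ((e div 2)\<^sup>2 + tri (e div 2)) else 0)"

text \<open>For m = 2i + 1 and n = 2j, mn = N^2 - D^2 + N - D, and \<open>e div 2\<close> is D; the
  weight supplies the rest of the exponent.\<close>

definition odd_weight :: "complex \<Rightarrow> int \<Rightarrow> int \<Rightarrow> complex" where
  "odd_weight q l e = (if odd e then q powi ((e div 2)\<^sup>2 + e div 2 + tri (e div 2) + l * (e div 2)) else 0)"

context
  fixes q :: complex
  assumes q: "norm q < 1" "q \<noteq> 0"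
begin

lemma qpoch_q_nonzero: "qpoch q q n \<noteq> 0"
  using qpoch_nonzero[OF q(1) q(1)] .

lemma powi_mult_eq: "x + y = z \<Longrightarrow> q powi x * q powi y = q powi z"
  using q by (simp flip: power_int_add)

lemma even_theta:
  "((\<lambda>d. q powi (d\<^sup>2 + tri d)) has_sum
     qpoch_inf (- q) (q ^ 3) * qpoch_inf (- (q ^ 2)) (q ^ 3) * qpoch_inf (q ^ 3) (q ^ 3)) UNIV"
proof -
  have "int 3 * tri d + 1 * d = d\<^sup>2 + tri d" for d
    using two_tri[of d] by (simp add: algebra_simps power2_eq_square)
  from theta_has_sum[OF q, of 3 1 1, unfolded this] show ?thesis
    by simp
qed

text \<open>Euler's pentagonal number theorem: the exponent is (3d^2 - d)/2, and at -1 the three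
  factors of the triple product are the residue classes modulo 3 of (q;q).\<close>

lemma alternating_theta:
  "((\<lambda>d. (-1) powi d * q powi (d\<^sup>2 + tri d)) has_sum qpoch_inf q q) UNIV"
proof -
  have exponent: "int 3 * tri d + 1 * d = d\<^sup>2 + tri d" for d
    using two_tri[of d] by (simp add: algebra_simps power2_eq_square)
  have "qpoch_inf q q = qpoch_inf q (q ^ 3) * qpoch_inf (q ^ 2) (q ^ 3) * qpoch_inf (q ^ 3) (q ^ 3)"
    using qpoch_inf_split_3[OF q(1), of q] by (simp add: eval_nat_numeral)
  with theta_has_sum[OF q, of 3 "-1" 1, unfolded exponent] show ?thesis
    by simp
qed

lemma odd_theta:
  "((\<lambda>d. q powi (d\<^sup>2 + d + tri d + l * d)) has_sum
     qpoch_inf (- (q powi (2 + l))) (q ^ 3) * qpoch_inf (- (q powi (1 - l))) (q ^ 3) * qpoch_inf (q ^ 3) (q ^ 3)) UNIV"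
proof -
  have "int 3 * tri d + (2 + l) * d = d\<^sup>2 + d + tri d + l * d" for d
    using two_tri[of d] by (simp add: algebra_simps power2_eq_square)
  from theta_has_sum[OF q, of 3 1 "2 + l", unfolded this] show ?thesis
    by simp
qed

text \<open>Adding or subtracting the alternating series leaves twice the terms with even or odd
  index. Their exponents 6d^2 - d and 6d^2 + 5d + 1 give theta series with base q^12.\<close>

lemma theta_even_odd_parts:
  assumes "((\<lambda>d. q powi (d\<^sup>2 + tri d)) has_sum W) UNIV"
  shows "W + qpoch_inf q q = 2 * qpoch_inf_list [- (q ^ 5), - (q ^ 7), q ^ 12] (q ^ 12)" (is ?even)
    and "W - qpoch_inf q q = 2 * q * qpoch_inf_list [- q, - (q ^ 11), q ^ 12] (q ^ 12)" (is ?odd)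
proof -
  define v where "v d = q powi (d\<^sup>2 + tri d)" for d
  have v: "(v has_sum W) UNIV" "((\<lambda>d. (-1) powi d * v d) has_sum qpoch_inf q q) UNIV"
    using assms alternating_theta by (simp_all only: v_def[abs_def])
  have even: "v (2 * d) = 1 powi d * q powi (int 12 * tri d + 5 * d)" for d
  proof -
    have "tri (2 * d) = 4 * tri d + d"
      by (rule tri_eqI) (use two_tri[of d] in \<open>simp add: algebra_simps\<close>)
    then have "(2 * d)\<^sup>2 + tri (2 * d) = int 12 * tri d + 5 * d"
      using two_tri[of d] by (simp add: algebra_simps power2_eq_square)
    then show ?thesis
      by (simp only: v_def power_int_1_left mult_1_left)
  qed
  have odd: "v (2 * d + 1) = q * (1 powi d * q powi (int 12 * tri d + 11 * d))" for d
  proof -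
    have "tri (2 * d + 1) = 4 * tri d + 3 * d"
      by (rule tri_eqI) (use two_tri[of d] in \<open>simp add: algebra_simps\<close>)
    then have "1 + (int 12 * tri d + 11 * d) = (2 * d + 1)\<^sup>2 + tri (2 * d + 1)"
      using two_tri[of d] by (simp add: algebra_simps power2_eq_square)
    from powi_mult_eq[OF this] show ?thesis
      by (simp only: v_def power_int_1_left mult_1_left power_int_1_right)
  qed
  have e: "((\<lambda>d. v (2 * d)) has_sum qpoch_inf_list [- (q ^ 5), - (q ^ 7), q ^ 12] (q ^ 12)) UNIV"
    unfolding even using theta_has_sum[OF q, of 12 1 5] by (simp add: qpoch_inf_list_def mult.assoc)
  have o: "((\<lambda>d. v (2 * d + 1)) has_sum q * qpoch_inf_list [- q, - (q ^ 11), q ^ 12] (q ^ 12)) UNIV"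
    unfolding odd using has_sum_cmult_right[OF theta_has_sum[OF q, of 12 1 11], of q]
    by (simp add: qpoch_inf_list_def mult_ac)
  have "((\<lambda>d. v d + (-1) powi d * v d) has_sum 2 * qpoch_inf_list [- (q ^ 5), - (q ^ 7), q ^ 12] (q ^ 12)) UNIV"
    by (rule has_sum_even_int) (use has_sum_cmult_right[OF e, of 2] in simp_all)
  with has_sum_add[OF v] show ?even
    by (rule has_sum_unique)
  have "((\<lambda>d. v d + (- 1) * ((-1) powi d * v d)) has_sum 2 * (q * qpoch_inf_list [- q, - (q ^ 11), q ^ 12] (q ^ 12))) UNIV"
    by (rule has_sum_odd_int) (use has_sum_cmult_right[OF o, of 2] in simp_all)
  with has_sum_add[OF v(1) has_sum_cmult_right[OF v(2), of "- 1"]]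
  have "W + (- 1) * qpoch_inf q q = 2 * (q * qpoch_inf_list [- q, - (q ^ 11), q ^ 12] (q ^ 12))"
    by (rule has_sum_unique)
  then show ?odd
    by simp
qed

lemma lattice_term_has_sum:
  assumes "(w has_sum W) UNIV"
  shows "((\<lambda>(m, n). lattice_term q w m n) has_sum W / qpoch_inf q q) UNIV"
  using durfee_weighted_sum[OF q(1) assms] unfolding lattice_term_def .

lemma lattice_term_even_weight:
  "lattice_term q (even_weight q) (2 * i) (2 * j) = summand q 0 0 0 0 i j"
  "lattice_term q (even_weight q) (2 * i + 1) (2 * j + 1) = q * summand q 1 1 2 0 i j"
  "lattice_term q (even_weight q) (2 * i) (2 * j + 1) = 0"
  "lattice_term q (even_weight q) (2 * i + 1) (2 * j) = 0"
proof -
  let ?D = "int i - int j" and ?N = "int i + int j"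
  have w: "even_weight q (2 * int i - 2 * int j) = q powi (?D\<^sup>2 + tri ?D)"
    unfolding even_weight_def right_diff_distrib[symmetric] by simp
  have "int (2 * i * (2 * j)) + (?D\<^sup>2 + tri ?D) = ?N\<^sup>2 + tri ?D"
    by (simp add: algebra_simps power2_eq_square)
  then have "q ^ (2 * i * (2 * j)) * q powi (?D\<^sup>2 + tri ?D) = q powi (?N\<^sup>2 + tri ?D)"
    by (metis powi_mult_eq power_int_of_nat)
  then show "lattice_term q (even_weight q) (2 * i) (2 * j) = summand q 0 0 0 0 i j"
    using w by (simp add: lattice_term_def summand_def)
  have "int ((2 * i + 1) * (2 * j + 1)) + (?D\<^sup>2 + tri ?D) = 1 + (?N\<^sup>2 + 2 * ?N + tri ?D)"
    by (simp add: algebra_simps power2_eq_square)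
  then have "q ^ ((2 * i + 1) * (2 * j + 1)) * q powi (?D\<^sup>2 + tri ?D) = q * q powi (?N\<^sup>2 + 2 * ?N + tri ?D)"
    by (metis powi_mult_eq power_int_1_right power_int_of_nat)
  then show "lattice_term q (even_weight q) (2 * i + 1) (2 * j + 1) = q * summand q 1 1 2 0 i j"
    using w by (simp add: lattice_term_def summand_def)
qed (simp_all add: lattice_term_def even_weight_def)

text \<open>Exchanging i and j maps the even-odd class to the odd-even one and replaces
  \<open>l\<close> by \<open>2 - l\<close>. Thus l = 0 pairs two different sums, while l = 1 is
  symmetric.\<close>

lemma lattice_term_odd_weight:
  "lattice_term q (odd_weight q l) (2 * i + 1) (2 * j) = summand q 1 0 1 l i j"
  "lattice_term q (odd_weight q l) (2 * i) (2 * j + 1) = q powi (1 - l) * summand q 1 0 1 (2 - l) j i"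
  "lattice_term q (odd_weight q l) (2 * i) (2 * j) = 0"
  "lattice_term q (odd_weight q l) (2 * i + 1) (2 * j + 1) = 0"
proof -
  let ?D = "int i - int j" and ?N = "int i + int j"
  have w: "odd_weight q l (2 * d + 1) = q powi (d\<^sup>2 + d + tri d + l * d)" for d
    unfolding odd_weight_def by simp
  have "int ((2 * i + 1) * (2 * j)) + (?D\<^sup>2 + ?D + tri ?D + l * ?D) = ?N\<^sup>2 + 1 * ?N + tri ?D + l * ?D"
    by (simp add: algebra_simps power2_eq_square)
  then have "q ^ ((2 * i + 1) * (2 * j)) * q powi (?D\<^sup>2 + ?D + tri ?D + l * ?D)
      = q powi (?N\<^sup>2 + 1 * ?N + tri ?D + l * ?D)"
    by (metis powi_mult_eq power_int_of_nat)
  moreover have "int (2 * i + 1) - int (2 * j) = 2 * ?D + 1"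
    by simp
  ultimately show "lattice_term q (odd_weight q l) (2 * i + 1) (2 * j) = summand q 1 0 1 l i j"
    unfolding lattice_term_def summand_def by (simp only: w) simp
  \<comment> \<open>Now m - n = 2D - 1 = 2(D - 1) + 1, so the weight is evaluated at D - 1.\<close>
  have "tri (?D - 1) = tri (- ?D) - 2 * ?D + 1"
    by (rule tri_eqI) (use two_tri[of "- ?D"] in \<open>simp add: algebra_simps\<close>)
  then have "int (2 * i * (2 * j + 1)) + ((?D - 1)\<^sup>2 + (?D - 1) + tri (?D - 1) + l * (?D - 1))
      = (1 - l) + ((int j + int i)\<^sup>2 + 1 * (int j + int i) + tri (int j - int i) + (2 - l) * (int j - int i))"
    by (simp add: algebra_simps power2_eq_square)
  then have "q ^ (2 * i * (2 * j + 1)) * q powi ((?D - 1)\<^sup>2 + (?D - 1) + tri (?D - 1) + l * (?D - 1))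
      = q powi (1 - l) * q powi ((int j + int i)\<^sup>2 + 1 * (int j + int i) + tri (int j - int i) + (2 - l) * (int j - int i))"
    by (metis powi_mult_eq power_int_of_nat)
  moreover have "int (2 * i) - int (2 * j + 1) = 2 * (?D - 1) + 1"
    by simp
  ultimately show "lattice_term q (odd_weight q l) (2 * i) (2 * j + 1) = q powi (1 - l) * summand q 1 0 1 (2 - l) j i"
    unfolding lattice_term_def summand_def by (simp only: w) (simp add: mult_ac)
qed (simp_all add: lattice_term_def odd_weight_def)

end

section \<open>The signed sum\<close>

text \<open>Summation by M = m + n. For odd M all weights vanish. For M = 2N the inner sum is a
  q-binomial sum at x = q^(-N), and (q^(-N);q)_(2N) has a zero factor unless N = 0. Only the term 1
  at M = 0 remains.\<close>

lemma alternating_lattice_sum: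
  assumes q: "norm q < 1" "q \<noteq> 0"
    and W: "(even_weight q has_sum W) UNIV"
  shows "((\<lambda>(m, n). (-1) ^ m * lattice_term q (even_weight q) m n) has_sum 1) UNIV"
proof -
  define g where "g m n = (-1) ^ m * lattice_term q (even_weight q) m n" for m n :: nat
  have "(\<lambda>p. norm (case p of (m, n) \<Rightarrow> lattice_term q (even_weight q) m n)) summable_on UNIV"
    using has_sum_imp_summable[OF lattice_term_has_sum[OF q W]]
      summable_on_iff_abs_summable_on_complex by blast
  then have "(\<lambda>p. norm (case p of (m, n) \<Rightarrow> g m n)) summable_on UNIV"
    by (simp add: g_def case_prod_beta' norm_mult norm_power)
  then obtain T where T: "((\<lambda>(m, n). g m n) has_sum T) UNIV"
    using summable_on_iff_abs_summable_on_complex summable_on_def by blast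
  have "((\<lambda>(M, m). g m (M - m)) has_sum T) (Sigma UNIV (\<lambda>M. {..M}))"
    by (rule has_sum_reindex_bij_witness[THEN iffD1, OF _ _ _ _ _ _ T,
          of "\<lambda>(M, m). (m, M - m)" "\<lambda>(m, n). (m + n, m)"]) auto
  then have "((\<lambda>M::nat. if M = 0 then 1 else 0) has_sum T) UNIV"
  proof (rule has_sum_SigmaD)
    fix M :: nat
    have "(\<Sum>m\<le>M. g m (M - m)) = (if M = 0 then 1 else 0)"
    proof (cases "even M")
      case False
      have "g m (M - m) = 0" if "m \<le> M" for m
      proof -
        have "int m - int (M - m) = 2 * int m - int M"
          using that by simp
        then show ?thesis
          using False by (simp add: g_def lattice_term_def even_weight_def)
      qed
      moreover have "M \<noteq> 0"
        using False by (intro notI) simp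
      ultimately show ?thesis
        by simp
    next
      case True
      then obtain N where M: "M = 2 * N"
        by (auto elim: evenE)
      \<comment> \<open>With d = m - N, m(2N - m) + d^2 = N^2, so the exponent depends on m only
        through \<open>tri d\<close>, that is, through "m choose 2" - Nm.\<close>
      have "g m (M - m) = q powi ((int N)\<^sup>2 + tri (- int N)) *
          ((-1) ^ m * q ^ (m choose 2) * (q powi (- int N)) ^ m / (qpoch q q m * qpoch q q (M - m)))"
        if "m \<le> M" for m
      proof -
        let ?d = "int m - int N"
        have d: "int m - int (M - m) = 2 * ?d"
          using that M by simp
        have "tri ?d = int (m choose 2) - int m * int N + tri (- int N)"
          by (rule tri_eqI)
            (use int_choose_two[of m] two_tri[of "- int N"] in \<open>simp add: algebra_simps\<close>)
        moreover have "int (m * (M - m)) = int m * (2 * int N - int m)"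
          using that M by simp
        ultimately have "int (m * (M - m)) + (?d\<^sup>2 + tri ?d)
            = ((int N)\<^sup>2 + tri (- int N)) + (int (m choose 2) + (- int N) * int m)"
          by (simp only:) (simp add: algebra_simps power2_eq_square)
        then have "q ^ (m * (M - m)) * q powi (?d\<^sup>2 + tri ?d)
            = q powi ((int N)\<^sup>2 + tri (- int N)) * (q ^ (m choose 2) * (q powi (- int N)) ^ m)"
          by (metis powi_mult_eq[OF q] power_int_of_nat power_int_mult)
        then show ?thesis
          unfolding g_def lattice_term_def d even_weight_def by (simp add: mult_ac)
      qed
      then have "(\<Sum>m\<le>M. g m (M - m)) = q powi ((int N)\<^sup>2 + tri (- int N)) *
          (qpoch (q powi (- int N)) q M / qpoch q q M)"
        unfolding q_binomial[OF q(1), symmetric] by (simp add: sum_distrib_left)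
      also have "\<dots> = (if M = 0 then 1 else 0)"
      proof (cases "M = 0")
        case True
        then show ?thesis
          using M by (simp add: tri_def)
      next
        case False
        \<comment> \<open>This factor occurs in the product because N < 2N = M when M is
          nonzero.\<close>
        have "q powi (- int N) * q ^ N = 1"
          using q by (simp add: power_int_minus)
        then have "qpoch (q powi (- int N)) q M = 0"
          unfolding qpoch_def using False M by (intro prod_zero) (auto intro!: bexI[of _ N])
        with False show ?thesis
          by simp
      qed
      finally show ?thesis .
    qed
    then show "((\<lambda>m. case (M, m) of (M, m) \<Rightarrow> g m (M - m)) has_sum (if M = 0 then 1 else 0)) {..M}"
      by (intro has_sum_finiteI) auto
  qed
  moreover have "((\<lambda>M::nat. if M = 0 then 1 else 0) has_sum (1::complex)) UNIV"
    by (rule has_sum_finite_neutralI[of "{0}"]) auto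
  ultimately have "T = 1"
    by (rule has_sum_unique)
  with T show ?thesis
    by (simp add: g_def)
qed

section \<open>Relations between the double sums\<close>

lemma has_sum_swap_args:
  "((\<lambda>(i, j). f i j) has_sum S) (UNIV :: ('a \<times> 'a) set) \<Longrightarrow> ((\<lambda>(i, j). f j i) has_sum S) UNIV"
  by (rule has_sum_reindex_bij_witness[of _ prod.swap prod.swap, THEN iffD1, rotated -1]) auto

text \<open>Writes 1 = (1 - y) + y, where 1 - y is the last factor of (q;q)_(2i+1). Summation gives
  S_3 = S_1 + q S_5; the arguments of the S_1 term are exchanged because
  \<open>tri (- D) = tri D + D\<close>.\<close>

lemma summand_split_left:
  assumes q: "norm q < 1" "q \<noteq> 0"
  shows "summand q 1 0 0 1 i j = summand q 0 0 0 0 j i + q * summand q 1 0 1 2 i j"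
proof -
  let ?D = "int i - int j" and ?N = "int i + int j"
  have P: "qpoch q q (2 * i + 1) = qpoch q q (2 * i) * (1 - q * q ^ (2 * i))"
    by (simp add: qpoch_Suc)
  have nz: "qpoch q q (2 * i) \<noteq> 0" "qpoch q q (2 * j) \<noteq> 0" "1 - q * q ^ (2 * i) \<noteq> 0"
    using qpoch_q_nonzero[OF q] one_minus_mult_power_nonzero[OF q(1) q(1)] by auto
  define X where "X = q powi (?N\<^sup>2 + 0 * ?N + tri ?D + 1 * ?D)"
  have "tri (- ?D) = tri ?D + ?D"
    by (rule tri_eqI) (use two_tri[of ?D] in \<open>simp add: algebra_simps\<close>)
  then have "(int j + int i)\<^sup>2 + 0 * (int j + int i) + tri (int j - int i) + 0 * (int j - int i)
      = ?N\<^sup>2 + 0 * ?N + tri ?D + 1 * ?D"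
    by (simp add: add.commute)
  then have 1: "summand q 0 0 0 0 j i = X / (qpoch q q (2 * j) * qpoch q q (2 * i))"
    by (simp add: summand_def X_def)
  have "1 + (?N\<^sup>2 + 1 * ?N + tri ?D + 2 * ?D) = int (2 * i + 1) + (?N\<^sup>2 + 0 * ?N + tri ?D + 1 * ?D)"
    by simp
  then have "q * q powi (?N\<^sup>2 + 1 * ?N + tri ?D + 2 * ?D) = q ^ (2 * i + 1) * X"
    unfolding X_def by (metis powi_mult_eq[OF q] power_int_of_nat power_int_1_right)
  then have 2: "q * summand q 1 0 1 2 i j = X * (q * q ^ (2 * i)) / (qpoch q q (2 * i + 1) * qpoch q q (2 * j))"
    by (simp add: summand_def mult_ac)
  have 3: "summand q 1 0 0 1 i j = X / (qpoch q q (2 * i + 1) * qpoch q q (2 * j))"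
    by (simp add: summand_def X_def)
  show ?thesis
    unfolding 1 2 3 P using nz by (simp add: field_simps)
qed

text \<open>The terms of S_4 and S_3 at (i, j) differ by the factor q^(2j) = 1 - (1 - q^(2j)), and 1
  - q^(2j) cancels the last factor of (q;q)_(2j). Summation gives S_4 = S_3 - q S_2; the correction
  is absent at j = 0.\<close>

lemma summand_split_right:
  assumes q: "norm q < 1" "q \<noteq> 0"
  shows "summand q 1 0 1 0 i 0 = summand q 1 0 0 1 i 0"
    and "summand q 1 0 1 0 i (Suc j) = summand q 1 0 0 1 i (Suc j) - q * summand q 1 1 2 0 i j"
proof -
  show "summand q 1 0 1 0 i 0 = summand q 1 0 0 1 i 0"
    by (simp add: summand_def add_ac)
  let ?D = "int i - int j" and ?N = "int i + int j"
  have P: "qpoch q q (2 * Suc j) = qpoch q q (2 * j + 1) * (1 - q * q ^ (2 * j + 1))"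
    by (simp add: qpoch_Suc)
  have nz: "qpoch q q (2 * i + 1) \<noteq> 0" "qpoch q q (2 * j + 1) \<noteq> 0" "1 - q * q ^ (2 * j + 1) \<noteq> 0"
    using qpoch_q_nonzero[OF q] one_minus_mult_power_nonzero[OF q(1) q(1)] by blast+
  define X where "X = q * q powi (?N\<^sup>2 + 2 * ?N + tri ?D + 0 * ?D)"
  have t: "tri (int i - int (Suc j)) = tri ?D - ?D + 1"
    by (rule tri_eqI) (use two_tri[of ?D] in \<open>simp add: algebra_simps\<close>)
  have "(int i + int (Suc j))\<^sup>2 + 0 * (int i + int (Suc j)) + tri (int i - int (Suc j)) + 1 * (int i - int (Suc j))
      = 1 + (?N\<^sup>2 + 2 * ?N + tri ?D + 0 * ?D)"
    unfolding t by (simp add: algebra_simps power2_eq_square)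
  then have "q powi ((int i + int (Suc j))\<^sup>2 + 0 * (int i + int (Suc j)) + tri (int i - int (Suc j)) + 1 * (int i - int (Suc j))) = X"
    unfolding X_def by (metis powi_mult_eq[OF q] power_int_1_right)
  then have 1: "summand q 1 0 0 1 i (Suc j) = X / (qpoch q q (2 * i + 1) * qpoch q q (2 * Suc j))"
    by (simp only: summand_def add_0_right)
  have "(int i + int (Suc j))\<^sup>2 + 1 * (int i + int (Suc j)) + tri (int i - int (Suc j)) + 0 * (int i - int (Suc j))
      = int (2 * j + 2) + (1 + (?N\<^sup>2 + 2 * ?N + tri ?D + 0 * ?D))"
    unfolding t by (simp add: algebra_simps power2_eq_square)
  then have "q powi ((int i + int (Suc j))\<^sup>2 + 1 * (int i + int (Suc j)) + tri (int i - int (Suc j)) + 0 * (int i - int (Suc j)))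
      = q ^ (2 * j + 2) * X"
    unfolding X_def by (metis powi_mult_eq[OF q] power_int_of_nat power_int_1_right)
  then have 2: "summand q 1 0 1 0 i (Suc j) = X * (q * q ^ (2 * j + 1)) / (qpoch q q (2 * i + 1) * qpoch q q (2 * Suc j))"
    by (simp only: summand_def add_0_right) (simp add: mult_ac)
  have 3: "q * summand q 1 1 2 0 i j = X / (qpoch q q (2 * i + 1) * qpoch q q (2 * j + 1))"
    by (simp add: summand_def X_def)
  have "X * y / (a * (b * (1 - y))) = X / (a * (b * (1 - y))) - X / (a * b)"
    if "a \<noteq> 0" "b \<noteq> 0" "1 - y \<noteq> 0" for a b y :: complex
    using that by (simp add: divide_simps) (simp add: algebra_simps)
  then show "summand q 1 0 1 0 i (Suc j) = summand q 1 0 0 1 i (Suc j) - q * summand q 1 1 2 0 i j"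
    unfolding 1 2 3 P using nz by blast
qed

text \<open>A prepended column of zeros aligns the terms at \<open>j\<close> with those at
  \<open>Suc j\<close>, as in \<open>summand_split_right\<close>.\<close>

lemma has_sum_shift_right:
  assumes "((\<lambda>(i, j). f i j) has_sum S) (UNIV :: ('a \<times> nat) set)"
  shows "((\<lambda>(i, j). case j of 0 \<Rightarrow> 0 | Suc j \<Rightarrow> f i j) has_sum S) UNIV"
proof -
  have "((\<lambda>(i, j). case j of 0 \<Rightarrow> 0 | Suc j \<Rightarrow> f i j) has_sum S) (range (\<lambda>(i, j). (i, Suc j)))"
    using assms by (subst has_sum_reindex) (auto simp: inj_def o_def case_prod_beta')
  then show ?thesis
    by (rule has_sum_cong_neutral[THEN iffD1, rotated -1]) (auto simp: image_iff split: nat.splits)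
qed

section \<open>Product forms of the theta series\<close>

text \<open>Both factors of Euler's identity are dissected modulo 3. The parts \<open>x\<close> and
  \<open>y\<close> from multiples of 3 form the same identity for q^3 and cancel.\<close>

lemma even_theta_product:
  assumes q: "norm q < 1" "q \<noteq> 0"
  shows "qpoch_inf (- q) (q ^ 3) * qpoch_inf (- (q ^ 2)) (q ^ 3) * qpoch_inf_list [q, q ^ 5] (q ^ 6) = 1"
proof -
  have n: "norm (q ^ 2) < 1" "norm (q ^ 3) < 1"
    using q by (simp_all add: norm_power power_less_one_iff)
  define x where "x = qpoch_inf (- (q ^ 3)) (q ^ 3)"
  define y where "y = qpoch_inf (q ^ 3) (q ^ 6)"
  have 1: "qpoch_inf (- q) q = qpoch_inf (- q) (q ^ 3) * qpoch_inf (- (q ^ 2)) (q ^ 3) * x"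
    using qpoch_inf_split_3[OF q(1), of "- q"] by (simp add: x_def eval_nat_numeral)
  have 2: "qpoch_inf q (q ^ 2) = qpoch_inf q (q ^ 6) * y * qpoch_inf (q ^ 5) (q ^ 6)"
    using qpoch_inf_split_3[OF n(1), of q] by (simp add: y_def flip: power_mult power_Suc)
  have "x * y = 1"
    using euler_odd_distinct[OF n(2)] by (simp add: x_def y_def flip: power_mult)
  moreover have "(qpoch_inf (- q) (q ^ 3) * qpoch_inf (- (q ^ 2)) (q ^ 3) * qpoch_inf_list [q, q ^ 5] (q ^ 6)) * (x * y) = 1"
    using euler_odd_distinct[OF q(1)] unfolding 1 2 qpoch_inf_list_def by (simp add: mult_ac)
  ultimately show ?thesis
    by simp
qed

text \<open>The 2 is the first factor 1 - (-1) of (-1;q); it later cancels against the two equal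
  halves that make up the series for S_6.\<close>

lemma odd_theta_product:
  assumes q: "norm q < 1"
  shows "qpoch_inf (- q) q * qpoch_inf (- 1) q * qpoch_inf q q * qpoch_inf q (q ^ 2) = 2 * qpoch_inf (q ^ 2) (q ^ 2)"
proof -
  have "qpoch_inf (- 1) q = 2 * qpoch_inf (- q) q"
    using qpoch_inf_first_factor[OF q, of "- 1"] by simp
  then have "qpoch_inf (- q) q * qpoch_inf (- 1) q * qpoch_inf q q * qpoch_inf q (q ^ 2)
      = 2 * (qpoch_inf (- q) q * qpoch_inf q q) * (qpoch_inf (- q) q * qpoch_inf q (q ^ 2))"
    by (simp add: mult_ac)
  then show ?thesis
    unfolding qpoch_inf_minus_mult[OF q] euler_odd_distinct[OF q] by simp
qed

section \<open>Evaluation of the six sums for nonzero q\<close>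

lemma summand_has_sum:
  assumes q: "norm q < 1" "q \<noteq> 0"
  defines "c \<equiv> qpoch_inf q q"
    and "A \<equiv> qpoch_inf_list [- (q ^ 5), - (q ^ 7), q ^ 12] (q ^ 12)"
    and "B \<equiv> qpoch_inf_list [- q, - (q ^ 11), q ^ 12] (q ^ 12)"
  shows "((\<lambda>(i, j). summand q 0 0 0 0 i j) has_sum A / c) UNIV"
    and "((\<lambda>(i, j). summand q 1 1 2 0 i j) has_sum B / c) UNIV"
    and "((\<lambda>(i, j). summand q 1 0 0 1 i j) has_sum
           qpoch_inf (q ^ 3) (q ^ 3) / (c * qpoch_inf_list [q, q ^ 5] (q ^ 6))) UNIV"
    and "((\<lambda>(i, j). summand q 1 0 1 0 i j) has_sum A / c) UNIV"
    and "((\<lambda>(i, j). summand q 1 0 1 2 i j) has_sum B / c) UNIV"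
    and "((\<lambda>(i, j). summand q 1 0 1 1 i j) has_sum
           qpoch_inf (q ^ 6) (q ^ 6) / (c * qpoch_inf (q ^ 3) (q ^ 6))) UNIV"
proof -
  define W where "W = qpoch_inf (- q) (q ^ 3) * qpoch_inf (- (q ^ 2)) (q ^ 3) * qpoch_inf (q ^ 3) (q ^ 3)"
  define V where "V = qpoch_inf (- (q ^ 3)) (q ^ 3) * qpoch_inf (- 1) (q ^ 3) * qpoch_inf (q ^ 3) (q ^ 3)"
  have n: "norm (q ^ 3) < 1"
    using q by (simp add: norm_power power_less_one_iff)
  have c: "c \<noteq> 0"
    unfolding c_def by (rule qpoch_inf_nonzero[OF q(1) q(1)])
  have W: "((\<lambda>d. q powi (d\<^sup>2 + tri d)) has_sum W) UNIV"
    unfolding W_def by (rule even_theta[OF q])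
  have We: "(even_weight q has_sum W) UNIV"
    by (rule has_sum_even_int) (use W in \<open>simp_all add: even_weight_def\<close>)
  have odd_weight: "(odd_weight q l has_sum qpoch_inf (- (q powi (2 + l))) (q ^ 3) *
      qpoch_inf (- (q powi (1 - l))) (q ^ 3) * qpoch_inf (q ^ 3) (q ^ 3)) UNIV" for l
    by (rule has_sum_odd_int) (use odd_theta[OF q, of l] in \<open>simp_all add: odd_weight_def\<close>)
  have W0: "(odd_weight q 0 has_sum W) UNIV"
    using odd_weight[of 0] by (simp add: W_def mult_ac)
  have V1: "(odd_weight q 1 has_sum V) UNIV"
    using odd_weight[of 1] by (simp add: V_def)
  note even_simps = lattice_term_even_weight[OF q] and odd_simps = lattice_term_odd_weight[OF q]

  obtain S1 Z Z' qS2 where S: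
    "((\<lambda>(i, j). summand q 0 0 0 0 i j) has_sum S1) UNIV"
    "((\<lambda>(i::nat, j::nat). 0) has_sum Z) UNIV" "((\<lambda>(i::nat, j::nat). 0) has_sum Z') UNIV"
    "((\<lambda>(i, j). q * summand q 1 1 2 0 i j) has_sum qS2) UNIV"
    "W / c = S1 + Z + Z' + qS2"
    using has_sum_parity_classes[OF lattice_term_has_sum[OF q We]] unfolding even_simps c_def by blast
  define S2 where "S2 = qS2 / q"
  have Z: "Z = 0" "Z' = 0"
    using S(2,3) by (auto simp: case_prod_beta' intro: has_sum_unique)
  have S2: "((\<lambda>(i, j). summand q 1 1 2 0 i j) has_sum S2) UNIV"
    using has_sum_cmult_right[OF S(4), of "1 / q"] q by (simp add: S2_def case_prod_beta')
  have plus: "S1 + q * S2 = W / c"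
    using S(5) Z q by (simp add: S2_def)
  have minus: "S1 - q * S2 = 1"
  proof -
    \<comment> \<open>The sign (-1)^m is 1 on the even-even class and -1 on the odd-odd
      class.\<close>
    obtain T1 Y Y' T2 where T:
      "((\<lambda>(i, j). (-1) ^ (2 * i) * summand q 0 0 0 0 i j) has_sum T1) UNIV"
      "((\<lambda>(i::nat, j::nat). (-1) ^ (2 * i) * 0) has_sum Y) UNIV"
      "((\<lambda>(i::nat, j::nat). (-1) ^ (2 * i + 1) * 0) has_sum Y') UNIV"
      "((\<lambda>(i, j). (-1) ^ (2 * i + 1) * (q * summand q 1 1 2 0 i j)) has_sum T2) UNIV"
      "1 = T1 + Y + Y' + T2"
      using has_sum_parity_classes[OF alternating_lattice_sum[OF q We]] unfolding even_simps by blast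
    have "Y = 0" "Y' = 0"
      using T(2,3) by (auto simp: case_prod_beta' intro: has_sum_unique)
    moreover have "T1 = S1"
      using T(1) S(1) by (simp add: has_sum_unique)
    moreover have "T2 = - qS2"
      using T(4) has_sum_cmult_right[OF S(4), of "- 1"]
      by (simp add: case_prod_beta' has_sum_unique)
    ultimately show ?thesis
      using T(5) q by (simp add: S2_def)
  qed

  obtain Z qS5 S4 Z' where S':
    "((\<lambda>(i::nat, j::nat). 0) has_sum Z) UNIV"
    "((\<lambda>(i, j). q powi (1 - 0) * summand q 1 0 1 (2 - 0) j i) has_sum qS5) UNIV"
    "((\<lambda>(i, j). summand q 1 0 1 0 i j) has_sum S4) UNIV" "((\<lambda>(i::nat, j::nat). 0) has_sum Z') UNIV"
    "W / c = Z + qS5 + S4 + Z'"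
    using has_sum_parity_classes[OF lattice_term_has_sum[OF q W0]] unfolding odd_simps c_def by blast
  define S5 where "S5 = qS5 / q"
  have Z: "Z = 0" "Z' = 0"
    using S'(1,4) by (auto simp: case_prod_beta' intro: has_sum_unique)
  have S5: "((\<lambda>(i, j). summand q 1 0 1 2 i j) has_sum S5) UNIV"
    using has_sum_cmult_right[OF has_sum_swap_args[OF S'(2)], of "1 / q"] q
    by (simp add: S5_def case_prod_beta')
  have plus': "S4 + q * S5 = W / c"
    using S'(5) Z q by (simp add: S5_def)
  have S3: "((\<lambda>(i, j). summand q 1 0 0 1 i j) has_sum S1 + q * S5) UNIV"
    using has_sum_add[OF has_sum_swap_args[OF S(1)] has_sum_cmult_right[OF S5, of q]]
    by (simp only: case_prod_beta' summand_split_left[OF q])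
  have "((\<lambda>(i, j). summand q 1 0 1 0 i j) has_sum (S1 + q * S5) + (- q) * S2) UNIV"
  proof -
    have "summand q 1 0 1 0 i j = summand q 1 0 0 1 i j + (- q) * (case j of 0 \<Rightarrow> 0 | Suc j \<Rightarrow> summand q 1 1 2 0 i j)"
      for i j using summand_split_right[OF q] by (cases j) simp_all
    then show ?thesis
      using has_sum_add[OF S3 has_sum_cmult_right[OF has_sum_shift_right[OF S2], of "- q"]]
      by (simp only: case_prod_beta')
  qed
  with S'(3) have "S4 = (S1 + q * S5) + (- q) * S2"
    by (rule has_sum_unique)
  \<comment> \<open>Both brackets equal W/c, which forces S_5 = S_2 and then S_4 = S_1.\<close>
  then have "2 * (q * (S5 - S2)) = (S4 + q * S5) - (S1 + q * S2)"
    by (simp add: algebra_simps)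
  then have "2 * (q * (S5 - S2)) = 0"
    unfolding plus plus' by simp
  with q have 52: "S5 = S2"
    by simp
  have 41: "S4 = S1"
    using plus plus' 52 by (metis add_right_cancel)
  \<comment> \<open>Sum and difference of \<open>plus\<close> and \<open>minus\<close>, with 1 =
    c/c; the numerators are those of \<open>theta_even_odd_parts\<close>.\<close>
  have "2 * S1 = (W + c) / c" "2 * (q * S2) = (W - c) / c"
    using plus minus c by (simp_all add: field_simps)
  then have "2 * S1 = 2 * (A / c)" "2 * (q * S2) = 2 * (q * (B / c))"
    using theta_even_odd_parts[OF q W] by (simp_all add: A_def B_def c_def)
  then have "S1 = A / c" "q * S2 = q * (B / c)"
    by (simp_all only: mult_cancel_left) simp_all
  then have AB: "S1 = A / c" "S2 = B / c"
    using q(2) mult_left_cancel by blast+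
  have "S1 + q * S5 = qpoch_inf (q ^ 3) (q ^ 3) / (c * qpoch_inf_list [q, q ^ 5] (q ^ 6))"
  proof -
    have "W / c = qpoch_inf (- q) (q ^ 3) * qpoch_inf (- (q ^ 2)) (q ^ 3) * qpoch_inf (q ^ 3) (q ^ 3) / c"
      by (simp add: W_def)
    moreover have "qpoch_inf (- q) (q ^ 3) * qpoch_inf (- (q ^ 2)) (q ^ 3) = 1 / qpoch_inf_list [q, q ^ 5] (q ^ 6)"
      using even_theta_product[OF q] by (metis mult_eq_0_iff nonzero_eq_divide_eq zero_neq_one)
    ultimately show ?thesis
      unfolding 52 plus by simp
  qed
  with S(1) S2 S3 S'(3) S5 AB 52 41
  show "((\<lambda>(i, j). summand q 0 0 0 0 i j) has_sum A / c) UNIV"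
    "((\<lambda>(i, j). summand q 1 1 2 0 i j) has_sum B / c) UNIV"
    "((\<lambda>(i, j). summand q 1 0 0 1 i j) has_sum
           qpoch_inf (q ^ 3) (q ^ 3) / (c * qpoch_inf_list [q, q ^ 5] (q ^ 6))) UNIV"
    "((\<lambda>(i, j). summand q 1 0 1 0 i j) has_sum A / c) UNIV"
    "((\<lambda>(i, j). summand q 1 0 1 2 i j) has_sum B / c) UNIV"
    by metis+

  \<comment> \<open>At l = 1 both mixed classes carry the same sum, whence the factor 2
    below.\<close>
  obtain Z S6' S6 Z' where T:
    "((\<lambda>(i::nat, j::nat). 0) has_sum Z) UNIV"
    "((\<lambda>(i, j). q powi (1 - 1) * summand q 1 0 1 (2 - 1) j i) has_sum S6') UNIV"
    "((\<lambda>(i, j). summand q 1 0 1 1 i j) has_sum S6) UNIV" "((\<lambda>(i::nat, j::nat). 0) has_sum Z') UNIV"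
    "V / c = Z + S6' + S6 + Z'"
    using has_sum_parity_classes[OF lattice_term_has_sum[OF q V1]] unfolding odd_simps c_def by blast
  have "Z = 0" "Z' = 0"
    using T(1,4) by (auto simp: case_prod_beta' intro: has_sum_unique)
  moreover have "S6' = S6"
    using has_sum_swap_args[OF T(2)] T(3) by (simp add: has_sum_unique)
  ultimately have "2 * S6 = V / c"
    using T(5) by simp
  then have "V = 2 * S6 * c"
    using c by (simp add: eq_divide_eq)
  moreover have "V * qpoch_inf (q ^ 3) (q ^ 6) = 2 * qpoch_inf (q ^ 6) (q ^ 6)"
    using odd_theta_product[OF n] by (simp add: V_def flip: power_mult)
  moreover have "qpoch_inf (q ^ 3) (q ^ 6) \<noteq> 0"
    using q by (intro qpoch_inf_nonzero) (simp_all add: norm_power power_less_one_iff)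
  ultimately have "2 * (S6 * (c * qpoch_inf (q ^ 3) (q ^ 6))) = 2 * qpoch_inf (q ^ 6) (q ^ 6)"
    and x: "qpoch_inf (q ^ 3) (q ^ 6) \<noteq> 0"
    using c by (simp_all add: eq_divide_eq mult_ac)
  then have "S6 * (c * qpoch_inf (q ^ 3) (q ^ 6)) = qpoch_inf (q ^ 6) (q ^ 6)"
    by (metis mult_left_cancel zero_neq_numeral)
  then have "S6 = qpoch_inf (q ^ 6) (q ^ 6) / (c * qpoch_inf (q ^ 3) (q ^ 6))"
    using c x by (simp add: eq_divide_eq)
  with T(3) show "((\<lambda>(i, j). summand q 1 0 1 1 i j) has_sum
           qpoch_inf (q ^ 6) (q ^ 6) / (c * qpoch_inf (q ^ 3) (q ^ 6))) UNIV"
    by simp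
qed

section \<open>Exponents and the case q = 0\<close>

lemma exponent_eq:
  "(3 * x\<^sup>2 + 2 * x * y + 3 * y\<^sup>2 + (2 * k + 2 * l - 1) * x + (2 * k - 2 * l + 1) * y) div 2
     = (x + y)\<^sup>2 + k * (x + y) + tri (x - y) + l * (x - y)"
proof -
  have "3 * x\<^sup>2 + 2 * x * y + 3 * y\<^sup>2 + (2 * k + 2 * l - 1) * x + (2 * k - 2 * l + 1) * y
      = 2 * ((x + y)\<^sup>2 + k * (x + y) + tri (x - y) + l * (x - y))"
    using two_tri[of "x - y"] by (simp add: algebra_simps power2_eq_square)
  then show ?thesis
    by simp
qed

lemma tri_nonneg: "tri d \<ge> 0"
proof -
  have "d * (d - 1) \<ge> 0"
    by (cases "d \<ge> 1") (auto intro: mult_nonneg_nonneg mult_nonpos_nonpos)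
  then show ?thesis
    using two_tri[of d] by linarith
qed

text \<open>As \<open>0 powi n\<close> is 1 at n = 0 and 0 otherwise, it suffices that the exponent
  is positive away from the origin.\<close>

lemma summand_0:
  assumes "(k, l) \<in> {(0, 0), (2, 0), (0, 1), (1, 0), (1, 2), (1, 1)}"
  shows "summand 0 a b k l i j = (if (i, j) = (0, 0) then 1 else 0)"
proof -
  have P: "qpoch 0 0 n = 1" for n
    by (simp add: qpoch_def)
  have "(int i + int j)\<^sup>2 + k * (int i + int j) + tri (int i - int j) + l * (int i - int j) > 0"
    if "(i, j) \<noteq> (0, 0)"
  proof -
    have N: "int i + int j \<ge> 1"
      using that by auto
    then have "(int i + int j)\<^sup>2 \<ge> 1"
      by simp
    \<comment> \<open>The left sides are \<open>tri (d + 1)\<close> and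
      \<open>tri (d + 2) - 1\<close>. The deficit -1 for l = 2 is outweighed by N^2 + N, as k = 1
      there.\<close>
    moreover have "tri d + d \<ge> 0" "tri d + 2 * d \<ge> - 1" for d
    proof -
      have "tri (d + 1) = tri d + d"
        by (rule tri_eqI) (use two_tri[of d] in \<open>simp add: algebra_simps\<close>)
      moreover have "tri (d + 2) = tri d + 2 * d + 1"
        by (rule tri_eqI) (use two_tri[of d] in \<open>simp add: algebra_simps\<close>)
      ultimately show "tri d + d \<ge> 0" "tri d + 2 * d \<ge> - 1"
        using tri_nonneg[of "d + 1"] tri_nonneg[of "d + 2"] by linarith+
    qed
    moreover have "X + k * N + T + l * D > 0"
      if "X \<ge> 1" "T + D \<ge> 0" "T + 2 * D \<ge> - 1" "N \<ge> 1" "T \<ge> 0" for X N T D :: int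
      using that assms by auto
    ultimately show ?thesis
      using N tri_nonneg[of "int i - int j"] by blast
  qed
  note pos = this
  show ?thesis
  proof (cases "(i, j) = (0, 0)")
    case True
    then show ?thesis
      by (simp add: summand_def P tri_def)
  next
    case False
    then have "(0::complex) powi ((int i + int j)\<^sup>2 + k * (int i + int j) + tri (int i - int j) + l * (int i - int j)) = 0"
      using pos by (intro power_int_0_left) fastforce
    with False show ?thesis
      unfolding summand_def by auto
  qed
qed

theorem theorem5p11:
  fixes q :: complex
  assumes "norm q < 1"
  shows
    "  ((\<lambda>(i::nat, j::nat).
        q powi ((3 * int i ^ 2 + 2 * int i * int j + 3 * int j ^ 2 - int i + int j) div 2)
          / (qpoch q q (2 * i) * qpoch q q (2 * j)))
      has_sum qpoch_inf_list [- (q ^ 5), - (q ^ 7), q ^ 12] (q ^ 12) / qpoch_inf q q) UNIV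
     \<and> ((\<lambda>(i::nat, j::nat).
        q powi ((3 * int i ^ 2 + 2 * int i * int j + 3 * int j ^ 2 + 3 * int i + 5 * int j) div 2)
          / (qpoch q q (2 * i + 1) * qpoch q q (2 * j + 1)))
      has_sum qpoch_inf_list [- q, - (q ^ 11), q ^ 12] (q ^ 12) / qpoch_inf q q) UNIV
     \<and> ((\<lambda>(i::nat, j::nat).
        q powi ((3 * int i ^ 2 + 2 * int i * int j + 3 * int j ^ 2 + int i - int j) div 2)
          / (qpoch q q (2 * i + 1) * qpoch q q (2 * j)))
      has_sum qpoch_inf (q ^ 3) (q ^ 3) / (qpoch_inf q q * qpoch_inf_list [q, q ^ 5] (q ^ 6))) UNIV
     \<and> ((\<lambda>(i::nat, j::nat).
        q powi ((3 * int i ^ 2 + 2 * int i * int j + 3 * int j ^ 2 + int i + 3 * int j) div 2)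
          / (qpoch q q (2 * i + 1) * qpoch q q (2 * j)))
      has_sum qpoch_inf_list [- (q ^ 5), - (q ^ 7), q ^ 12] (q ^ 12) / qpoch_inf q q) UNIV
     \<and> ((\<lambda>(i::nat, j::nat).
        q powi ((3 * int i ^ 2 + 2 * int i * int j + 3 * int j ^ 2 + 5 * int i - int j) div 2)
          / (qpoch q q (2 * i + 1) * qpoch q q (2 * j)))
      has_sum qpoch_inf_list [- q, - (q ^ 11), q ^ 12] (q ^ 12) / qpoch_inf q q) UNIV
     \<and> ((\<lambda>(i::nat, j::nat).
        q powi ((3 * int i ^ 2 + 2 * int i * int j + 3 * int j ^ 2 + 3 * int i + int j) div 2)
          / (qpoch q q (2 * i + 1) * qpoch q q (2 * j)))
      has_sum qpoch_inf (q ^ 6) (q ^ 6) / (qpoch_inf q q * qpoch_inf (q ^ 3) (q ^ 6))) UNIV"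
proof -
  have e:
    "(3 * int i ^ 2 + 2 * int i * int j + 3 * int j ^ 2 - int i + int j) div 2
       = (int i + int j)\<^sup>2 + 0 * (int i + int j) + tri (int i - int j) + 0 * (int i - int j)"
    "(3 * int i ^ 2 + 2 * int i * int j + 3 * int j ^ 2 + 3 * int i + 5 * int j) div 2
       = (int i + int j)\<^sup>2 + 2 * (int i + int j) + tri (int i - int j) + 0 * (int i - int j)"
    "(3 * int i ^ 2 + 2 * int i * int j + 3 * int j ^ 2 + int i - int j) div 2
       = (int i + int j)\<^sup>2 + 0 * (int i + int j) + tri (int i - int j) + 1 * (int i - int j)"
    "(3 * int i ^ 2 + 2 * int i * int j + 3 * int j ^ 2 + int i + 3 * int j) div 2
       = (int i + int j)\<^sup>2 + 1 * (int i + int j) + tri (int i - int j) + 0 * (int i - int j)"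
    "(3 * int i ^ 2 + 2 * int i * int j + 3 * int j ^ 2 + 5 * int i - int j) div 2
       = (int i + int j)\<^sup>2 + 1 * (int i + int j) + tri (int i - int j) + 2 * (int i - int j)"
    "(3 * int i ^ 2 + 2 * int i * int j + 3 * int j ^ 2 + 3 * int i + int j) div 2
       = (int i + int j)\<^sup>2 + 1 * (int i + int j) + tri (int i - int j) + 1 * (int i - int j)"
    for i j
    unfolding exponent_eq[symmetric] by simp_all
  have "((\<lambda>(i, j). summand q 0 0 0 0 i j) has_sum
            qpoch_inf_list [- (q ^ 5), - (q ^ 7), q ^ 12] (q ^ 12) / qpoch_inf q q) UNIV
      \<and> ((\<lambda>(i, j). summand q 1 1 2 0 i j) has_sum
            qpoch_inf_list [- q, - (q ^ 11), q ^ 12] (q ^ 12) / qpoch_inf q q) UNIV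
      \<and> ((\<lambda>(i, j). summand q 1 0 0 1 i j) has_sum
            qpoch_inf (q ^ 3) (q ^ 3) / (qpoch_inf q q * qpoch_inf_list [q, q ^ 5] (q ^ 6))) UNIV
      \<and> ((\<lambda>(i, j). summand q 1 0 1 0 i j) has_sum
            qpoch_inf_list [- (q ^ 5), - (q ^ 7), q ^ 12] (q ^ 12) / qpoch_inf q q) UNIV
      \<and> ((\<lambda>(i, j). summand q 1 0 1 2 i j) has_sum
            qpoch_inf_list [- q, - (q ^ 11), q ^ 12] (q ^ 12) / qpoch_inf q q) UNIV
      \<and> ((\<lambda>(i, j). summand q 1 0 1 1 i j) has_sum
            qpoch_inf (q ^ 6) (q ^ 6) / (qpoch_inf q q * qpoch_inf (q ^ 3) (q ^ 6))) UNIV"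
  \<comment> \<open>The general argument divides by q and uses its negative powers; at q = 0 both
    sides of every identity are 1.\<close>
  proof (cases "q = 0")
    case True
    have "((\<lambda>(i, j). summand 0 a b k l i j) has_sum 1) UNIV"
      if "(k, l) \<in> {(0, 0), (2, 0), (0, 1), (1, 0), (1, 2), (1, 1)}" for a b k l
      by (rule has_sum_finite_neutralI[of "{(0, 0)}"]) (use summand_0[OF that] in \<open>auto split: if_splits\<close>)
    with True show ?thesis
      by (simp add: qpoch_inf_list_def qpoch_inf_def)
  next
    case False
    with summand_has_sum[OF assms False] show ?thesis
      by blast
  qed
  then show ?thesis
    unfolding summand_def e[symmetric] add_0_right .
qed

end
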